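(* Let $A\in\mathbb{R}^{n\times n}$ and consider the continuous-time system $\dot x(t)=A\,x(t)$, $t\ge 0$. The following statements are equivalent: (a) the system $\dot x(t)=Ax(t)$ is convergent; (b) there exists $\epsilon>0$ such that the system $\dot x(t)=A(I+\epsilon A)^{-1}x(t)$ is (well defined and) (marginally) stable; (c) there exists a weak polyhedral Lyapunov function for the system $\dot x(t)=Ax(t)$; (d) there exists an invertible matrix $T\in\mathbb{R}^{n\times n}$ such that $$T^{-1}AT=\begin{bmatrix}A^{\mathrm{as}} & 0\\ A^{\mathrm{r}} & 0\end{bmatrix}$$ for some Hurwitz matrix $A^{\mathrm{as}}$; (e) there exists $\tau>0$ such that the discrete-time system $x(k+1)=(I+\tau A)x(k)$ is convergent; (f) there exist $\epsilon>0$ and $P\succ 0$ such that $$A^\top P+PA+\epsilon A^\top PA\preccurlyeq 0;$$ (g) there exist $Q\succ 0$ and $P\succcurlyeq 0$ with $\mathrm{rank}(P)=n-\dim(\ker(A))$ such that $$A^\top P+PA+A^\top QA\preccurlyeq 0 .$$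
   Context: A linear time-invariant system (in continuous or discrete time) is convergent if for every initial condition $x(0)\in\mathbb{R}^n$ there exists $\bar x\in\mathbb{R}^n$ such that the solution $x$ converges to $\bar x$ as time tends to $\infty$. A system is (marginally) stable if it is at least marginally stable, i.e. the origin is Lyapunov stable. A weak Lyapunov function for $\dot x=Ax$ is a positive definite function $V:\mathbb{R}^n\to\mathbb{R}_{\ge0}$ with $\dot V(x)\le 0$ for all $x$, where, for nonsmooth $V$, $\dot V(x)=\limsup_{h\to0^+}\frac{V(x+hAx)-V(x)}{h}$; it is a weak polyhedral Lyapunov function if moreover $V(x)=\max_{i=1,\dots,s}f_i^\top x$ for some vectors $f_1,\dots,f_s\in\mathbb{R}^n$. A Hurwitz matrix is a square matrix with all eigenvalues in the open left half-plane. Blocks in (d) may be empty. $P\succ 0$ ($P\succcurlyeq 0$) means that $P$ is symmetric positive definite (semi-definite), and $M\preccurlyeq 0$ means $-M\succcurlyeq 0$. In (b), the invertibility of $I+\epsilon A$ is part of the requirement. *)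

theory Defs
  imports "Jordan_Normal_Form.Char_Poly" "HOL-Analysis.Analysis"
begin

section \<open>Linear time-invariant systems\<close>

definition ct_solution :: "real^'n^'n \<Rightarrow> (real \<Rightarrow> real^'n) \<Rightarrow> bool" where
  "ct_solution A x \<longleftrightarrow>
     (\<forall>t\<ge>0. (x has_vector_derivative (A *v x t)) (at t within {0..}))"

definition dt_solution :: "real^'n^'n \<Rightarrow> (nat \<Rightarrow> real^'n) \<Rightarrow> bool" where
  "dt_solution A x \<longleftrightarrow> (\<forall>k. x (Suc k) = A *v x k)"

text \<open>Solutions exist and are unique for every initial condition, so quantifying over all solutions
  starting at \<open>x0\<close> amounts to speaking of the solution starting at \<open>x0\<close>.\<close>

definition ct_convergent :: "real^'n^'n \<Rightarrow> bool" where
  "ct_convergent A \<longleftrightarrow>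
     (\<forall>x0. \<exists>xbar. \<forall>x. ct_solution A x \<and> x 0 = x0 \<longrightarrow> (x \<longlongrightarrow> xbar) at_top)"

definition dt_convergent :: "real^'n^'n \<Rightarrow> bool" where
  "dt_convergent A \<longleftrightarrow>
     (\<forall>x0. \<exists>xbar. \<forall>x. dt_solution A x \<and> x 0 = x0 \<longrightarrow> x \<longlonglongrightarrow> xbar)"

definition ct_stable :: "real^'n^'n \<Rightarrow> bool" where
  "ct_stable A \<longleftrightarrow>
     (\<forall>\<epsilon>>0. \<exists>\<delta>>0. \<forall>x. ct_solution A x \<and> norm (x 0) < \<delta> \<longrightarrow> (\<forall>t\<ge>0. norm (x t) < \<epsilon>))"


section \<open>Weak Lyapunov functions\<close>

definition dini_derivative :: "real^'n^'n \<Rightarrow> (real^'n \<Rightarrow> real) \<Rightarrow> real^'n \<Rightarrow> ereal" where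
  "dini_derivative A V x =
     Limsup (at_right 0) (\<lambda>h. ereal ((V (x + h *\<^sub>R (A *v x)) - V x) / h))"

definition positive_definite_fun :: "(real^'n \<Rightarrow> real) \<Rightarrow> bool" where
  "positive_definite_fun V \<longleftrightarrow> V 0 = 0 \<and> (\<forall>x. x \<noteq> 0 \<longrightarrow> V x > 0)"

definition weak_lyapunov :: "real^'n^'n \<Rightarrow> (real^'n \<Rightarrow> real) \<Rightarrow> bool" where
  "weak_lyapunov A V \<longleftrightarrow> positive_definite_fun V \<and> (\<forall>x. dini_derivative A V x \<le> 0)"

definition weak_polyhedral_lyapunov :: "real^'n^'n \<Rightarrow> (real^'n \<Rightarrow> real) \<Rightarrow> bool" where
  "weak_polyhedral_lyapunov A V \<longleftrightarrow> weak_lyapunov A V \<and>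
     (\<exists>s::nat. s \<ge> 1 \<and> (\<exists>f :: nat \<Rightarrow> real^'n. \<forall>x. V x = Max ((\<lambda>i. f i \<bullet> x) ` {1..s})))"


section \<open>Matrices\<close>

definition pos_semidef :: "real^'n^'n \<Rightarrow> bool" where
  "pos_semidef P \<longleftrightarrow> transpose P = P \<and> (\<forall>x. x \<bullet> (P *v x) \<ge> 0)"

definition pos_def :: "real^'n^'n \<Rightarrow> bool" where
  "pos_def P \<longleftrightarrow> transpose P = P \<and> (\<forall>x. x \<noteq> 0 \<longrightarrow> x \<bullet> (P *v x) > 0)"

abbreviation id_matrix :: "real^'n^'n" where
  "id_matrix \<equiv> Finite_Cartesian_Product.mat 1"

text \<open>The index type of \<open>real^'n^'n\<close> carries no order, whereas a block partition needs one. Relative to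
  a numbering \<open>e\<close> of the coordinates by \<open>0, \<dots>, n - 1\<close>, \<open>array_of e\<close> turns a matrix into
  the corresponding \<open>n \<times> n\<close> array, to which the block operations for matrices of
  varying dimension apply.\<close>

definition array_of :: "(nat \<Rightarrow> 'n) \<Rightarrow> real^'n^'n \<Rightarrow> real Matrix.mat" where
  "array_of e B = Matrix.mat CARD('n) CARD('n) (\<lambda>(i, j). B $ e i $ e j)"

definition hurwitz :: "real Matrix.mat \<Rightarrow> bool" where
  "hurwitz B \<longleftrightarrow> square_mat B \<and>
     (\<forall>\<mu>::complex. eigenvalue (map_mat complex_of_real B) \<mu> \<longrightarrow> Re \<mu> < 0)"

end

theory Submission
  imports Defs
begin

text \<open>
  Every one of the seven conditions is compared with one spectral condition on \<open>A\<close>, called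
  \<open>convergent_spectrum\<close> below: \<open>ker A\<^sup>2 = ker A\<close>, and every complex eigenvalue other
  than \<open>0\<close> has negative real part.

  Necessity is elementary in each case, because only two kinds of explicit trajectories have to be
  inspected. If \<open>A w = 0\<close> and \<open>w = A z\<close>, then \<open>z + t w\<close> solves the
  continuous-time system and \<open>z + k \<tau> w\<close> solves its Euler discretization
  \<open>x(k+1) = (I + \<tau> A) x(k)\<close>; boundedness forces \<open>w = 0\<close>. If \<open>v\<close> is an
  eigenvector for \<open>\<mu>\<close>, the real vectors \<open>Re (c v)\<close>, with \<open>c\<close> complex, are
  mapped to one another by \<open>A\<close>, which multiplies \<open>c\<close> by \<open>\<mu>\<close>, so trajectories are
  \<open>Re (c exp(t \<mu>) v)\<close> or \<open>Re (c (1 + \<tau> \<mu>)\<^sup>k v)\<close>. Convergence of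
  \<open>exp(t \<mu>)\<close> gives \<open>\<mu> = 0\<close> or \<open>Re \<mu> < 0\<close>. Mere boundedness of
  \<open>(1 + \<tau> \<mu>)\<^sup>k\<close> gives the same, since the disc \<open>|1 + \<tau> \<mu>| \<le> 1\<close> meets the
  closed right half-plane only in \<open>0\<close>. The resolvent \<open>A (I + \<epsilon> A)\<^sup>-\<^sup>1\<close> sends
  \<open>\<mu>\<close> to \<open>\<mu> / (1 + \<epsilon> \<mu>)\<close>, which lies in the closed left half-plane exactly when
  \<open>\<mu>\<close> lies in the disc for \<open>\<tau> = 2 \<epsilon>\<close>. This is why plain stability of the modified systems implies
  convergence of the original one.

  Quadratic and polyhedral Lyapunov functions enter through the same door: each makes some Euler step
  \<open>I + \<tau> A\<close> nonexpansive, hence power bounded. For the inequality in (f) this is the identity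
  \<open>(I + \<epsilon> A)\<^sup>T P (I + \<epsilon> A) = P + \<epsilon> (A\<^sup>T P + P A + \<epsilon> A\<^sup>T P A)\<close>. For a polyhedral
  function, the value along the ray \<open>x + h A x\<close> is piecewise affine in \<open>h\<close>, so the Dini
  condition keeps it from increasing for small \<open>h\<close>; a single \<open>h\<close> serves the finitely many vertices of the unit
  ball and therefore, by convexity, the whole space.

  For sufficiency, the spectral condition first yields a convergent Euler discretization. The eigenvalues
  are finitely many, so one small \<open>\<tau>\<close> puts \<open>1 + \<tau> \<mu>\<close> into the open unit disc for all nonzero ones;
  \<open>iterates_tendsto_0\<close> then handles the range of \<open>A\<close>, by induction on the degree
  of an annihilating polynomial, and the kernel is fixed pointwise. Let \<open>M = I + \<tau> A\<close> be convergent
  with limit projection \<open>K\<close>, and put \<open>E\<^sub>k = M\<^sup>k (I - K)\<close>. Since \<open>E\<^sub>m\<close> is small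
  compared with \<open>E\<^sub>0\<close> for some \<open>m\<close>, finitely many of the \<open>E\<^sub>k\<close>
  suffice to write down explicit Lyapunov functions: the sum of \<open>|E\<^sub>k x|\<^sup>2\<close> over
  \<open>k < m\<close> for (g), the same sum plus \<open>|K x|\<^sup>2\<close> for (f), and the maximum of the absolute
  values of the coordinates of \<open>K x\<close> and all \<open>E\<^sub>k x\<close> for (c). Finally, (f) implies (a)
  and (b) by differentiating the quadratic form along solutions, (g) reduces to (f), and (d) is the spectral
  condition expressed in a basis adapted to the decomposition into range and kernel.
\<close>

text \<open>Components and inner products are those of the finite Cartesian products
  \<open>real^'n\<close> and \<open>complex^'n\<close>.\<close>

no_notation Matrix.vec_index (infixl "$" 100)
no_notation Matrix.scalar_prod (infix "\<bullet>" 70)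

section \<open>Complexification, the spectral condition and real slices\<close>

definition complexify :: "real^'n^'n \<Rightarrow> complex^'n^'n" where
  "complexify A = map_matrix complex_of_real A"

text \<open>The common characterization to which all conditions are reduced. The first conjunct says that
  the eigenvalue \<open>0\<close> is semisimple.\<close>

definition convergent_spectrum :: "real^'n^'n \<Rightarrow> bool" where
  "convergent_spectrum A \<longleftrightarrow>
     (\<forall>z. A *v (A *v z) = 0 \<longrightarrow> A *v z = 0) \<and>
     (\<forall>\<mu> v. v \<noteq> 0 \<and> complexify A *v v = \<mu> *s v \<longrightarrow> \<mu> = 0 \<or> Re \<mu> < 0)"

lemma complexify_mult: "complexify (A ** B) = complexify A ** complexify B"
  by (simp add: vec_eq_iff complexify_def matrix_matrix_mult_def)

lemma complexify_id: "complexify id_matrix = Finite_Cartesian_Product.mat 1"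
  by (simp add: vec_eq_iff complexify_def Finite_Cartesian_Product.mat_def)

text \<open>For an eigenvector \<open>v\<close>, the real span of the real and imaginary parts of \<open>v\<close>
  is an invariant plane (or line) of the real matrix. It is parametrized here by a complex number, so that
  the matrix acts on the parameter as multiplication by the eigenvalue.\<close>

definition re_slice :: "complex \<Rightarrow> complex^'n \<Rightarrow> real^'n" where
  "re_slice c v = (\<chi> i. Re (c * v $ i))"

lemma matrix_mult_re_slice: "A *v re_slice c v = re_slice c (complexify A *v v)"
  by (simp add: vec_eq_iff re_slice_def complexify_def matrix_vector_mult_def sum_distrib_left
      Re_sum algebra_simps sum_subtractf)

lemma re_slice_smult: "re_slice c (\<mu> *s v) = re_slice (c * \<mu>) v"
  by (simp add: re_slice_def mult.assoc)

lemma re_slice_add: "re_slice (c + d) v = re_slice c v + re_slice d v"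
  by (simp add: vec_eq_iff re_slice_def algebra_simps)

lemma re_slice_scaleR: "re_slice (r *\<^sub>R c) v = r *\<^sub>R re_slice c v"
  by (simp add: vec_eq_iff re_slice_def algebra_simps)

lemma norm_re_slice_le: "norm (re_slice c v) \<le> norm c * norm v"
proof -
  have "norm (re_slice c v) \<le> norm (\<chi> i. c * v $ i)"
    unfolding norm_vec_def re_slice_def by (rule L2_set_mono) (simp_all add: abs_Re_le_cmod del: times_complex.sel)
  also have "\<dots> = norm c * norm v"
    unfolding norm_vec_def by (simp add: norm_mult L2_set_right_distrib)
  finally show ?thesis .
qed

text \<open>Choosing \<open>d\<close> as the inverse of a nonzero component of \<open>v\<close> makes the slice of
  \<open>r d\<close> equal to \<open>r\<close> in that component. This turns growth of a complex factor into growth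
  of a real trajectory.\<close>

lemma re_slice_expansive:
  assumes "v \<noteq> 0"
  shows "\<exists>d. \<forall>r. \<bar>r\<bar> \<le> norm (re_slice (of_real r * d) v)"
proof -
  obtain i where i: "v $ i \<noteq> 0" using assms by (auto simp: vec_eq_iff)
  show ?thesis
  proof (intro exI allI)
    fix r
    have "re_slice (of_real r * inverse (v $ i)) v $ i = r"
    proof -
      have "of_real r * inverse (v $ i) * v $ i = of_real r" using i by (simp add: mult.assoc)
      thus ?thesis by (simp only: re_slice_def vec_lambda_beta Re_complex_of_real)
    qed
    thus "\<bar>r\<bar> \<le> norm (re_slice (of_real r * inverse (v $ i)) v)"
      by (metis component_le_norm_cart)
  qed
qed

lemma re_slice_eq_0_imp: assumes "\<And>c. re_slice c v = 0" shows "v = 0"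
proof (rule ccontr)
  assume "v \<noteq> 0"
  then obtain d where "\<And>r. \<bar>r\<bar> \<le> norm (re_slice (of_real r * d) v)"
    using re_slice_expansive by blast
  from this[of 1] show False by (simp add: assms)
qed

lemma complexify_kernel:
  assumes "\<And>z. A *v (A *v z) = 0 \<Longrightarrow> A *v z = 0"
    and "complexify A *v (complexify A *v z) = 0"
  shows "complexify A *v z = 0"
proof (rule re_slice_eq_0_imp)
  fix c
  have "A *v (A *v re_slice c z) = 0"
    using assms(2) by (simp add: matrix_mult_re_slice) (simp add: re_slice_def vec_eq_iff)
  thus "re_slice c (complexify A *v z) = 0"
    using assms(1) by (simp flip: matrix_mult_re_slice)
qed

lemma funpow_complexify_of_real:
  "((*v) (complexify M) ^^ k) (\<chi> i. of_real (x $ i)) = (\<chi> i. of_real (((*v) M ^^ k) x $ i))"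
  by (induction k) (simp_all add: vec_eq_iff matrix_vector_mult_def complexify_def)

lemma complexify_of_real_vec:
  "complexify A *v (\<chi> i. of_real (x $ i)) = (\<chi> i. of_real ((A *v x) $ i))"
  using funpow_complexify_of_real[of 1 A x] by simp

text \<open>Used to rotate the phase of an initial state so that the state at one chosen time has a real
  parameter.\<close>

lemma cnj_sgn_mult: "cnj (sgn w) * w = of_real (norm w)"
proof (cases "w = 0")
  case False
  have "cnj (sgn w) * w = (w * cnj w) / of_real (norm w)"
    by (simp add: sgn_eq mult.commute)
  thus ?thesis
    using False unfolding complex_norm_square[symmetric] by (simp add: power2_eq_square)
qed simp

section \<open>Iterated matrices and Euler steps\<close>

lemma funpow_matrix_linear: "linear ((*v) (B :: 'a::real_algebra_1^'n^'n) ^^ i)"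
proof (induction i)
  case 0
  show ?case unfolding funpow.simps by (rule linear_id)
next
  case (Suc i)
  show ?case unfolding funpow.simps by (rule linear_compose[OF Suc matrix_vector_mul_linear])
qed

lemma linear_norm_le_axis_sum:
  fixes f :: "real^'n \<Rightarrow> real^'m"
  assumes "linear f"
  shows "norm (f x) \<le> (\<Sum>i\<in>UNIV. norm (f (axis i 1))) * norm x"
proof -
  have "f x = f (\<Sum>i\<in>UNIV. x $ i *\<^sub>R axis i 1)"
    using basis_expansion[of x] by (simp add: scalar_mult_eq_scaleR)
  also have "\<dots> = (\<Sum>i\<in>UNIV. x $ i *\<^sub>R f (axis i 1))"
    by (simp add: linear_sum[OF assms] linear_scale[OF assms])
  also have "norm \<dots> \<le> (\<Sum>i\<in>UNIV. norm x * norm (f (axis i 1)))"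
    by (rule sum_norm_le) (auto intro!: mult_right_mono component_le_norm_cart)
  finally show ?thesis by (simp add: sum_distrib_left mult.commute)
qed

text \<open>Solutions of the recursion are exactly the orbits of the matrix.\<close>

lemma dt_convergent_iff: "dt_convergent M \<longleftrightarrow> (\<forall>x. convergent (\<lambda>k. ((*v) M ^^ k) x))"
proof -
  have sol: "dt_solution M x \<and> x 0 = x0 \<longleftrightarrow> x = (\<lambda>k. ((*v) M ^^ k) x0)" for x x0
  proof
    assume x: "dt_solution M x \<and> x 0 = x0"
    have "x k = ((*v) M ^^ k) x0" for k
      by (induction k) (use x in \<open>simp_all add: dt_solution_def\<close>)
    thus "x = (\<lambda>k. ((*v) M ^^ k) x0)" by blast
  qed (simp add: dt_solution_def)
  have "(\<exists>xbar. \<forall>x. dt_solution M x \<and> x 0 = x0 \<longrightarrow> x \<longlonglongrightarrow> xbar)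
      \<longleftrightarrow> convergent (\<lambda>k. ((*v) M ^^ k) x0)" for x0
    by (simp add: sol convergent_def)
  thus ?thesis by (simp add: dt_convergent_def)
qed

lemma complexify_euler:
  "complexify (id_matrix + \<tau> *\<^sub>R A) *v v = v + of_real \<tau> *s (complexify A *v v)"
proof -
  have "complexify (id_matrix + \<tau> *\<^sub>R A) = Finite_Cartesian_Product.mat 1 + \<tau> *\<^sub>R complexify A"
    by (simp add: vec_eq_iff complexify_def Finite_Cartesian_Product.mat_def)
      (simp add: scaleR_conv_of_real)
  moreover have "(\<tau> *\<^sub>R complexify A) *v v = of_real \<tau> *s (complexify A *v v)"
    by (simp add: vec_eq_iff matrix_vector_mult_def sum_distrib_left scaleR_conv_of_real[where 'a=complex] mult.assoc)
  ultimately show ?thesis by (simp add: matrix_vector_mult_add_rdistrib)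
qed

lemma euler_mult: "(id_matrix + \<tau> *\<^sub>R A) *v x = x + \<tau> *\<^sub>R (A *v x)" for A :: "real^'n^'n"
  by (simp add: matrix_vector_mult_add_rdistrib scaleR_matrix_vector_assoc)

section \<open>Splitting the space into kernel and range\<close>

text \<open>The matrix is injective on its range, hence maps it onto itself by a dimension count. Subtracting
  \<open>A z\<close> from \<open>x\<close> therefore splits \<open>x\<close> into a kernel and a range component.\<close>

lemma range_square:
  fixes A :: "real^'n^'n"
  assumes "\<And>z. A *v (A *v z) = 0 \<Longrightarrow> A *v z = 0"
  obtains z where "A *v x = A *v (A *v z)"
proof -
  let ?R = "range ((*v) A)"
  have sR: "subspace ?R" by (intro linear_subspace_image) auto
  have "inj_on ((*v) A) ?R"
  proof (rule inj_onI)
    fix u w assume "u \<in> ?R" "w \<in> ?R" "A *v u = A *v w"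
    then obtain y where y: "u - w = A *v y" using subspace_diff[OF sR] by (metis imageE)
    have "A *v (u - w) = 0" using \<open>A *v u = A *v w\<close> by (simp add: matrix_vector_mult_diff_distrib)
    hence "u - w = 0" using assms[of y] unfolding y by blast
    thus "u = w" by simp
  qed
  hence "dim ((*v) A ` ?R) = dim ?R"
    using sR by (intro dim_image_eq) (auto simp: span_eq_iff[THEN iffD2])
  hence "(*v) A ` ?R = ?R"
    by (intro subspace_dim_equal linear_subspace_image sR) auto
  thus ?thesis using that by (metis image_iff rangeI)
qed

text \<open>If the kernel and the range are complementary, \<open>K\<close> is the projection onto the kernel along
  the range and \<open>L\<close> inverts \<open>A\<close> on the range. The last equation recovers a vector from its
  projection and its velocity, which is how convergence of \<open>A x(t)\<close> becomes convergence of
  \<open>x(t)\<close>.\<close>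

lemma group_inverse:
  fixes A :: "real^'n^'n"
  assumes ker: "\<And>z. A *v (A *v z) = 0 \<Longrightarrow> A *v z = 0"
  obtains K L :: "real^'n^'n" where "\<And>x. A *v (K *v x) = 0" "\<And>x. K *v (A *v x) = 0"
    "\<And>x. x = K *v x + L *v (A *v x)"
proof -
  let ?R = "range ((*v) A)"
  have "subspace ?R" by (intro linear_subspace_image) auto
  from linear_exists_right_inverse_on[OF matrix_vector_mul_linear[of A] this] obtain g
    where g: "range g \<subseteq> ?R" "linear g" "\<And>v. v \<in> (*v) A ` ?R \<Longrightarrow> A *v g v = v"
    by auto
  define L where "L = matrix g"
  have L: "L *v x = g x" for x using g(2) by (simp add: L_def matrix_works)
  define K where "K = id_matrix - L ** A"
  have K: "K *v x = x - L *v (A *v x)" for x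
    by (simp add: K_def matrix_vector_mult_diff_rdistrib matrix_vector_mul_assoc)
  have 1: "A *v (K *v x) = 0" for x
  proof -
    obtain z where "A *v x = A *v (A *v z)" using range_square[OF ker] by blast
    hence "A *v (g (A *v x)) = A *v x" by (intro g(3)) auto
    thus ?thesis by (simp add: K L matrix_vector_mult_diff_distrib)
  qed
  show thesis
  proof
    show "A *v (K *v x) = 0" for x by (rule 1)
    show "x = K *v x + L *v (A *v x)" for x by (simp add: K)
    show "K *v (A *v x) = 0" for x
    proof -
      obtain y where y: "L *v (A *v (A *v x)) = A *v y" using g(1) by (auto simp: L)
      have eq: "K *v (A *v x) = A *v (x - y)" by (simp add: K y matrix_vector_mult_diff_distrib)
      have "A *v (A *v (x - y)) = 0" using 1[of "A *v x"] unfolding eq .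
      thus ?thesis unfolding eq by (rule ker)
    qed
  qed
qed

section \<open>Polynomials in a matrix and convergence of its iterates\<close>

text \<open>The vector \<open>p(B) v\<close>.\<close>

definition poly_action :: "complex^'n^'n \<Rightarrow> complex poly \<Rightarrow> complex^'n \<Rightarrow> complex^'n" where
  "poly_action B p v = (\<Sum>i\<le>degree p. coeff p i *s ((*v) B ^^ i) v)"

lemma poly_action_eq:
  assumes "degree p \<le> N"
  shows "poly_action B p v = (\<Sum>i\<le>N. coeff p i *s ((*v) B ^^ i) v)"
  unfolding poly_action_def using assms
  by (intro sum.mono_neutral_left) (auto simp: coeff_eq_0)

lemma funpow_smult: "((*v) (B :: complex^'n^'n) ^^ i) (c *s v) = c *s ((*v) B ^^ i) v"
  by (induction i) (auto simp: vector_scalar_commute)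

lemma poly_action_diff: "poly_action B p (v - w) = poly_action B p v - poly_action B p w"
  unfolding poly_action_def
  by (simp add: linear_diff[OF funpow_matrix_linear] vector_ssub_ldistrib sum_subtractf)

lemma poly_action_smult: "poly_action B p (c *s v) = c *s poly_action B p v"
  unfolding poly_action_def
  by (simp add: funpow_smult vec.scale_sum_right vector_smult_assoc mult.commute)

lemma poly_action_matrix: "poly_action B p (B *v v) = B *v poly_action B p v"
  unfolding poly_action_def
  by (simp add: vec.linear_sum[OF matrix_vector_mul_linear_gen] vector_scalar_commute funpow_swap1)

text \<open>In this form, if the product annihilates \<open>v\<close>, then the remaining factor \<open>q\<close>
  annihilates \<open>B v - \<mu> v\<close>.\<close>

lemma poly_action_linear_factor:
  "poly_action B ([:-\<mu>, 1:] * q) v = poly_action B q (B *v v - \<mu> *s v)"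
proof -
  define N where "N = degree q"
  have "degree ([:-\<mu>, 1:] * q) \<le> Suc N"
    by (rule order.trans[OF degree_mult_le]) (simp add: N_def)
  hence "poly_action B ([:-\<mu>, 1:] * q) v
      = (\<Sum>i\<le>Suc N. coeff ([:-\<mu>, 1:] * q) i *s ((*v) B ^^ i) v)"
    by (rule poly_action_eq)
  also have "\<dots> = (\<Sum>i\<le>Suc N. coeff (pCons 0 q) i *s ((*v) B ^^ i) v)
      - (\<Sum>i\<le>Suc N. (\<mu> * coeff q i) *s ((*v) B ^^ i) v)"
  proof -
    have "coeff ([:-\<mu>, 1:] * q) i = coeff (pCons 0 q) i - \<mu> * coeff q i" for i by simp
    thus ?thesis by (simp only: vec.scale_left_diff_distrib sum_subtractf)
  qed
  also have "(\<Sum>i\<le>Suc N. coeff (pCons 0 q) i *s ((*v) B ^^ i) v) = poly_action B q (B *v v)"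
    by (simp add: sum.atMost_Suc_shift poly_action_def N_def funpow_swap1 del: sum.atMost_Suc)
  also have "(\<Sum>i\<le>Suc N. (\<mu> * coeff q i) *s ((*v) B ^^ i) v) = \<mu> *s poly_action B q v"
    by (simp add: poly_action_eq[of q "Suc N"] N_def vec.scale_sum_right vector_smult_assoc
        del: sum.atMost_Suc)
  finally show ?thesis by (simp add: poly_action_diff poly_action_smult)
qed

lemma poly_action_eigenvector:
  assumes "B *v v = \<mu> *s v"
  shows "poly_action B p v = poly p \<mu> *s v"
proof -
  have "((*v) B ^^ i) v = \<mu> ^ i *s v" for i
    by (induction i) (auto simp: vector_scalar_commute assms vector_smult_assoc mult.commute)
  thus ?thesis
    by (simp add: poly_action_def poly_altdef vector_smult_assoc vec.scale_sum_left)
qed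

text \<open>Linear dependence for families rather than sets: a repeated vector already gives a
  nontrivial relation.\<close>

lemma many_vectors_dependent:
  fixes f :: "nat \<Rightarrow> 'a::euclidean_space"
  shows "\<exists>c. (\<exists>i\<le>DIM('a). c i \<noteq> (0::real)) \<and> (\<Sum>i\<le>DIM('a). c i *\<^sub>R f i) = 0"
proof (cases "inj_on f {..DIM('a)}")
  case True
  have "dependent (f ` {..DIM('a)})"
  proof (rule ccontr)
    assume "\<not> ?thesis"
    from independent_card_le[OF this] card_image[OF True] show False by simp
  qed
  then obtain u where u: "\<exists>v\<in>f ` {..DIM('a)}. u v \<noteq> 0" "(\<Sum>v\<in>f ` {..DIM('a)}. u v *\<^sub>R v) = 0"
    by (subst (asm) dependent_finite) auto
  show ?thesis
    by (rule exI[of _ "u \<circ> f"]) (use u True in \<open>auto simp: sum.reindex\<close>)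
next
  case False
  then obtain i j where ij: "i \<le> DIM('a)" "j \<le> DIM('a)" "i \<noteq> j" "f i = f j"
    by (auto simp: inj_on_def)
  let ?c = "\<lambda>k. (if k = i then 1 else 0) - (if k = j then 1 else (0::real))"
  have "(\<Sum>k\<le>DIM('a). ?c k *\<^sub>R f k) = f i - f j"
    using ij by (simp add: algebra_simps sum_subtractf if_distrib[of "\<lambda>r. r *\<^sub>R _"] cong: if_cong)
  thus ?thesis using ij by (intro exI[of _ ?c]) auto
qed

text \<open>The powers of \<open>B\<close> live in a finite-dimensional real space, so some nontrivial real
  combination of them vanishes. One polynomial works for all vectors, which makes the eigenvalues finite in
  number.\<close>

lemma annihilating_polynomial:
  fixes B :: "complex^'n^'n"
  shows "\<exists>p. p \<noteq> 0 \<and> (\<forall>v. poly_action B p v = 0)"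
proof -
  define N where "N = DIM(complex^'n^'n)"
  define f where "f i = ((**) B ^^ i) (Finite_Cartesian_Product.mat 1 :: complex^'n^'n)" for i
  have f: "f i *v v = ((*v) B ^^ i) v" for i v
    by (induction i) (auto simp: f_def simp flip: matrix_vector_mul_assoc)
  obtain c :: "nat \<Rightarrow> real" where c: "\<exists>i\<le>N. c i \<noteq> 0" "(\<Sum>i\<le>N. c i *\<^sub>R f i) = 0"
    using many_vectors_dependent[of f] unfolding N_def by blast
  define p where "p = (\<Sum>i\<le>N. monom (complex_of_real (c i)) i)"
  have coeff: "coeff p k = (if k \<le> N then c k else 0)" for k
    by (simp add: p_def coeff_sum)
  have "degree p \<le> N" by (rule degree_le) (simp add: coeff)
  hence "poly_action B p v = (\<Sum>i\<le>N. coeff p i *s ((*v) B ^^ i) v)" for v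
    by (rule poly_action_eq)
  also have "(\<Sum>i\<le>N. coeff p i *s ((*v) B ^^ i) v) = (\<Sum>i\<le>N. c i *\<^sub>R f i) *v v" for v
  proof -
    have "(\<Sum>i\<le>N. c i *\<^sub>R f i) *v v = (\<Sum>i\<le>N. (c i *\<^sub>R f i) *v v)"
      by (induction N) (auto simp: matrix_vector_mult_add_rdistrib)
    also have "\<dots> = (\<Sum>i\<le>N. coeff p i *s ((*v) B ^^ i) v)"
    proof (rule sum.cong[OF refl])
      fix i assume "i \<in> {..N}"
      have "(c i *\<^sub>R f i) *v v = coeff p i *s (f i *v v)"
        using \<open>i \<in> {..N}\<close> by (simp add: coeff vec_eq_iff matrix_vector_mult_def sum_distrib_left scaleR_conv_of_real[where 'a=complex] mult.assoc)
      thus "(c i *\<^sub>R f i) *v v = coeff p i *s ((*v) B ^^ i) v" by (simp add: f)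
    qed
    finally show ?thesis by simp
  qed
  finally have "\<forall>v. poly_action B p v = 0" by (simp add: c)
  moreover have "p \<noteq> 0" using c(1) coeff by (metis coeff_0 of_real_eq_0_iff)
  ultimately show ?thesis by blast
qed

lemma finite_eigenvalues:
  fixes B :: "complex^'n^'n"
  shows "finite {\<mu>. \<exists>v. v \<noteq> 0 \<and> B *v v = \<mu> *s v}"
proof -
  obtain p where p: "p \<noteq> 0" "\<And>v. poly_action B p v = 0" using annihilating_polynomial by blast
  have "{\<mu>. \<exists>v. v \<noteq> 0 \<and> B *v v = \<mu> *s v} \<subseteq> {\<mu>. poly p \<mu> = 0}"
    using p(2) by (auto simp: vector_mul_eq_0 dest: poly_action_eigenvector[of _ _ _ p])
  thus ?thesis using poly_roots_finite[OF p(1)] finite_subset by blast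
qed

text \<open>A strict contraction driven by a vanishing input.\<close>

lemma affine_recursion_tendsto_0:
  fixes s w :: "nat \<Rightarrow> complex"
  assumes l: "norm z < 1" and w: "w \<longlonglongrightarrow> 0" and s: "\<And>k. s (Suc k) = z * s k + w k"
  shows "s \<longlonglongrightarrow> 0"
proof (rule LIMSEQ_I)
  fix e :: real assume e: "e > 0"
  define r where "r = norm z"
  have r: "0 \<le> r" "r < 1" using l by (auto simp: r_def)
  have "e * (1 - r) / 2 > 0" using e r by simp
  from LIMSEQ_D[OF w this] obtain N where N: "\<And>k. k \<ge> N \<Longrightarrow> norm (w k) < e * (1 - r) / 2"
    by auto
  have bd: "norm (s (N + j)) \<le> r ^ j * norm (s N) + e / 2" for j
  proof (induction j)
    case 0 show ?case using e by simp
  next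
    case (Suc j)
    have "norm (s (N + Suc j)) \<le> r * norm (s (N + j)) + norm (w (N + j))"
      using norm_triangle_ineq[of "z * s (N+j)" "w (N+j)"] by (simp add: s norm_mult r_def)
    also have "\<dots> \<le> r * (r ^ j * norm (s N) + e / 2) + e * (1 - r) / 2"
      using N[of "N+j"] r Suc by (intro add_mono mult_left_mono) auto
    finally show ?case by (simp add: field_simps)
  qed
  have "(\<lambda>j. r ^ j * norm (s N)) \<longlonglongrightarrow> 0"
    by (rule tendsto_mult_left_zero[OF LIMSEQ_power_zero]) (use r in simp)
  from LIMSEQ_D[OF this, of "e/2"] e obtain K where K: "\<And>j. j \<ge> K \<Longrightarrow> norm (r ^ j * norm (s N)) < e / 2"
    by auto
  show "\<exists>no. \<forall>n\<ge>no. norm (s n - 0) < e"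
  proof (intro exI allI impI)
    fix n assume n: "n \<ge> N + K"
    then obtain j where j: "n = N + j" "j \<ge> K" by (intro that[of "n - N"]) auto
    show "norm (s n - 0) < e" using bd[of j] K[OF j(2)] j(1) r by auto
  qed
qed

text \<open>Restricting to an invariant subspace \<open>W\<close> allows the eigenvalue \<open>1\<close> of an Euler step
  to be left out. The induction removes one root \<open>\<mu>\<close> of an annihilating polynomial at a time. If
  \<open>|\<mu>| < 1\<close>, the orbit of \<open>v\<close> is driven by the orbit of \<open>B v - \<mu> v\<close>, which
  vanishes by induction. Otherwise \<open>\<mu>\<close> is not an eigenvalue on \<open>W\<close>, and the remaining
  factor alone annihilates \<open>v\<close>.\<close>

lemma iterates_tendsto_0:
  fixes B :: "complex^'n^'n"
  assumes W: "vec.subspace W" and BW: "\<And>v. v \<in> W \<Longrightarrow> B *v v \<in> W"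
    and ev: "\<And>v \<mu>. \<lbrakk>v \<in> W; v \<noteq> 0; B *v v = \<mu> *s v\<rbrakk> \<Longrightarrow> norm \<mu> < 1"
    and v: "v \<in> W"
  shows "(\<lambda>k. ((*v) B ^^ k) v) \<longlonglongrightarrow> 0"
proof -
  have *: "(\<lambda>k. ((*v) B ^^ k) v) \<longlonglongrightarrow> 0"
    if "degree p = m" "p \<noteq> 0" "poly_action B p v = 0" "v \<in> W" for p m v
    using that
  proof (induction m arbitrary: p v)
    case 0
    then obtain a where a: "p = [:a:]" using degree_eq_zeroE by blast
    with 0 have "v = 0" by (auto simp: poly_action_def vector_mul_eq_0)
    moreover have "((*v) B ^^ k) 0 = 0" for k
      by (induction k) auto
    ultimately show ?case by simp
  next
    case (Suc m)
    have "\<not> constant (poly p)" using Suc.prems(1) by (simp add: constant_degree)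
    then obtain \<mu> where "poly p \<mu> = 0" using fundamental_theorem_of_algebra by blast
    then obtain q where q: "p = [:-\<mu>, 1:] * q" by (metis dvd_def poly_eq_0_iff_dvd)
    with Suc.prems have q0: "q \<noteq> 0" by auto
    have dq: "degree q = m" using Suc.prems(1) q q0 degree_mult_eq[of "[:-\<mu>,1:]" q] by simp
    define w where "w = B *v v - \<mu> *s v"
    have wW: "w \<in> W" using W BW Suc.prems by (simp add: w_def vec.subspace_diff vec.subspace_scale)
    have qw: "poly_action B q w = 0" using Suc.prems(3) unfolding q poly_action_linear_factor w_def .
    note w0 = Suc.IH[OF dq q0 qw wW]
    show ?case
    proof (cases "norm \<mu> < 1")
      case True
      have Bw: "((*v) B ^^ k) w = ((*v) B ^^ Suc k) v - \<mu> *s ((*v) B ^^ k) v" for k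
        by (simp add: w_def linear_diff[OF funpow_matrix_linear] funpow_smult funpow_swap1)
      show ?thesis
      proof (rule vec_tendstoI)
        fix i
        have "(\<lambda>k. ((*v) B ^^ k) w $ i) \<longlonglongrightarrow> 0"
          using tendsto_vec_nth[OF w0, of i] by simp
        moreover have "((*v) B ^^ Suc k) v $ i = \<mu> * ((*v) B ^^ k) v $ i + ((*v) B ^^ k) w $ i" for k
          by (simp add: Bw del: funpow.simps)
        ultimately show "(\<lambda>k. ((*v) B ^^ k) v $ i) \<longlonglongrightarrow> 0 $ i"
          using affine_recursion_tendsto_0[OF True] by auto
      qed
    next
      case False
      define u where "u = poly_action B q v"
      have BkW: "((*v) B ^^ i) v \<in> W" for i
        by (induction i) (auto simp: BW Suc.prems)
      have "u \<in> W"
        unfolding u_def poly_action_def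
        by (intro vec.subspace_sum[OF W] vec.subspace_scale[OF W] BkW)
      moreover have "B *v u = \<mu> *s u"
        using Suc.prems(3)
        unfolding q poly_action_linear_factor poly_action_diff poly_action_smult poly_action_matrix
        by (simp add: u_def)
      ultimately have "u = 0" using ev False by blast
      thus ?thesis using Suc.IH[OF dq q0] Suc.prems by (simp add: u_def)
    qed
  qed
  show ?thesis using annihilating_polynomial[of B] * v by blast
qed

section \<open>The spectral condition yields a convergent Euler discretization\<close>

text \<open>Because \<open>|1 + \<tau> \<mu>|\<^sup>2 = 1 + \<tau> (2 Re \<mu> + \<tau> |\<mu>|\<^sup>2)\<close>.\<close>

lemma eventually_euler_factor_contractive:
  assumes "Re \<mu> < 0"
  shows "eventually (\<lambda>\<tau>. norm (1 + of_real \<tau> * \<mu>) < 1) (at_right 0)"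
proof -
  have "\<mu> \<noteq> 0" using assms by auto
  \<comment> \<open>The second zero of the quadratic polynomial \<open>\<tau> (2 Re \<mu> + \<tau> |\<mu>|\<^sup>2)\<close>.\<close>
  define b where "b = - 2 * Re \<mu> / (norm \<mu>)\<^sup>2"
  have "b > 0" using assms \<open>\<mu> \<noteq> 0\<close> by (simp add: b_def divide_neg_pos)
  hence "eventually (\<lambda>\<tau>. \<tau> \<in> {0<..<b}) (at_right 0)"
    by (rule eventually_at_right_real)
  thus ?thesis
  proof eventually_elim
    case (elim \<tau>)
    have "\<tau> * (norm \<mu>)\<^sup>2 < - 2 * Re \<mu>"
      using elim \<open>\<mu> \<noteq> 0\<close> by (simp add: b_def field_simps)
    hence "\<tau> * (\<tau> * (norm \<mu>)\<^sup>2) < \<tau> * (- 2 * Re \<mu>)"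
      using elim by (intro mult_strict_left_mono) auto
    moreover have "(norm (1 + of_real \<tau> * \<mu>))\<^sup>2 = 1 + 2 * \<tau> * Re \<mu> + \<tau> * (\<tau> * (norm \<mu>)\<^sup>2)"
      unfolding cmod_power2 by (simp add: power2_eq_square algebra_simps)
    ultimately have "(norm (1 + of_real \<tau> * \<mu>))\<^sup>2 < 1\<^sup>2" by simp
    thus ?case by (rule power_less_imp_less_base) simp
  qed
qed

text \<open>The orbit of \<open>x\<close> is a constant kernel component plus an orbit in the range of
  \<open>A\<close>. On the range the eigenvalue \<open>0\<close> of \<open>A\<close> does not occur, so all eigenvalues of
  the Euler step there lie in the open unit disc.\<close>

theorem convergent_spectrum_imp_euler_convergent:
  fixes A :: "real^'n^'n"
  assumes "convergent_spectrum A"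
  shows "\<exists>\<tau>>0. dt_convergent (id_matrix + \<tau> *\<^sub>R A)"
proof -
  from assms have ker: "\<And>z. A *v (A *v z) = 0 \<Longrightarrow> A *v z = 0"
    and ev: "\<And>\<mu> v. \<lbrakk>v \<noteq> 0; complexify A *v v = \<mu> *s v\<rbrakk> \<Longrightarrow> \<mu> = 0 \<or> Re \<mu> < 0"
    by (auto simp: convergent_spectrum_def)
  define E where "E = {\<mu>. \<exists>v. v \<noteq> 0 \<and> complexify A *v v = \<mu> *s v}"
  have "finite (E - {0})" unfolding E_def using finite_eigenvalues by blast
  moreover have "\<forall>\<mu>\<in>E - {0}. eventually (\<lambda>\<tau>. norm (1 + of_real \<tau> * \<mu>) < 1) (at_right 0)"
    using ev eventually_euler_factor_contractive by (auto simp: E_def)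
  ultimately have "eventually (\<lambda>\<tau>. \<forall>\<mu>\<in>E - {0}. norm (1 + of_real \<tau> * \<mu>) < 1) (at_right 0)"
    by (simp add: eventually_ball_finite_distrib)
  hence "eventually (\<lambda>\<tau>::real. \<tau> > 0 \<and> (\<forall>\<mu>\<in>E - {0}. norm (1 + of_real \<tau> * \<mu>) < 1)) (at_right 0)"
    using eventually_at_right_less eventually_conj by blast
  from eventually_happens'[OF _ this] obtain \<tau> :: real
    where \<tau>: "\<tau> > 0" "\<And>\<mu>. \<lbrakk>\<mu> \<in> E; \<mu> \<noteq> 0\<rbrakk> \<Longrightarrow> norm (1 + of_real \<tau> * \<mu>) < 1"
    by auto
  define M where "M = id_matrix + \<tau> *\<^sub>R A"
  define W where "W = range ((*v) (complexify A))"
  have W: "vec.subspace W"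
    unfolding W_def by (rule vec.subspace_image) (rule vec.subspace_UNIV)
  have MW: "complexify M *v v \<in> W" if "v \<in> W" for v
  proof -
    have "complexify A *v v \<in> W" by (simp add: W_def)
    with that show ?thesis
      by (simp add: M_def complexify_euler vec.subspace_add[OF W] vec.subspace_scale[OF W])
  qed
  have evM: "norm \<nu> < 1" if v: "v \<in> W" "v \<noteq> 0" "complexify M *v v = \<nu> *s v" for v \<nu>
  proof -
    define \<mu> where "\<mu> = (\<nu> - 1) / of_real \<tau>"
    have \<nu>: "\<nu> = 1 + of_real \<tau> * \<mu>" using \<tau>(1) by (simp add: \<mu>_def)
    have "of_real \<tau> *s (complexify A *v v) = of_real \<tau> *s (\<mu> *s v)"
      using v(3) unfolding M_def complexify_euler \<nu>
      by (simp add: vec.scale_left_distrib vector_smult_assoc)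
    hence A: "complexify A *v v = \<mu> *s v" using \<tau>(1) by (simp only: vector_mul_lcancel) simp
    have "\<mu> \<noteq> 0"
    proof
      assume "\<mu> = 0"
      moreover obtain z where "v = complexify A *v z" using v(1) by (auto simp: W_def)
      ultimately have "v = 0" using complexify_kernel[OF ker, of z] A by auto
      thus False using v(2) by simp
    qed
    moreover have "\<mu> \<in> E" using A v(2) by (auto simp: E_def)
    ultimately show ?thesis using \<tau>(2) \<nu> by simp
  qed
  have "convergent (\<lambda>k. ((*v) M ^^ k) x)" for x
  proof -
    obtain z where z: "A *v x = A *v (A *v z)" using range_square[OF ker] by blast
    have "(\<lambda>k. ((*v) M ^^ k) (A *v z)) \<longlonglongrightarrow> 0"
    proof (rule vec_tendstoI)
      fix i
      have "(\<chi> i. of_real ((A *v z) $ i)) \<in> W"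
        using funpow_complexify_of_real[of 1 A z] by (auto simp: W_def intro: sym)
      from iterates_tendsto_0[OF W MW evM this]
      have "(\<lambda>k. ((*v) (complexify M) ^^ k) (\<chi> i. of_real ((A *v z) $ i))) \<longlonglongrightarrow> 0" .
      from tendsto_vec_nth[OF this, of i]
      have "(\<lambda>k. complex_of_real (((*v) M ^^ k) (A *v z) $ i)) \<longlonglongrightarrow> complex_of_real 0"
        by (simp add: funpow_complexify_of_real)
      thus "(\<lambda>k. ((*v) M ^^ k) (A *v z) $ i) \<longlonglongrightarrow> 0 $ i"
        unfolding tendsto_of_real_iff by simp
    qed
    hence "(\<lambda>k. (x - A *v z) + ((*v) M ^^ k) (A *v z)) \<longlonglongrightarrow> (x - A *v z) + 0"
      by (intro tendsto_intros)
    moreover have "((*v) M ^^ k) (x - A *v z) = x - A *v z" for k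
      by (induction k) (auto simp: M_def euler_mult matrix_vector_mult_diff_distrib z)
    hence "((*v) M ^^ k) x = (x - A *v z) + ((*v) M ^^ k) (A *v z)" for k
      using linear_diff[OF funpow_matrix_linear[where B=M and i=k], of x "A *v z"] by simp
    ultimately show ?thesis unfolding convergent_def by auto
  qed
  thus ?thesis using \<tau>(1) by (auto simp: dt_convergent_iff M_def)
qed

section \<open>Bounded discrete-time systems satisfy the spectral condition\<close>

lemma funpow_euler_re_slice:
  assumes "complexify A *v v = \<mu> *s v"
  shows "((*v) (id_matrix + \<tau> *\<^sub>R A) ^^ k) (re_slice c v) = re_slice (c * (1 + of_real \<tau> * \<mu>) ^ k) v"
proof (induction k)
  case (Suc k)
  have "(id_matrix + \<tau> *\<^sub>R A) *v re_slice d v = re_slice (d * (1 + of_real \<tau> * \<mu>)) v" for d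
  proof -
    have "(id_matrix + \<tau> *\<^sub>R A) *v re_slice d v = re_slice (d + \<tau> *\<^sub>R (d * \<mu>)) v"
      unfolding euler_mult unfolding matrix_mult_re_slice assms re_slice_smult re_slice_add re_slice_scaleR ..
    also have "d + \<tau> *\<^sub>R (d * \<mu>) = d * (1 + of_real \<tau> * \<mu>)"
      by (simp add: scaleR_conv_of_real algebra_simps)
    finally show ?thesis .
  qed
  thus ?case by (simp add: Suc mult_ac)
qed simp

text \<open>Bounded powers, rather than convergent ones, are enough: a unimodular
  eigenvalue \<open>1 + \<tau> \<mu>\<close> other than \<open>1\<close> still has \<open>Re \<mu> < 0\<close>.\<close>

lemma power_bounded_euler_imp_spectrum:
  fixes A :: "real^'n^'n"
  assumes \<tau>: "\<tau> > 0"
    and bd: "\<And>k x. norm (((*v) (id_matrix + \<tau> *\<^sub>R A) ^^ k) x) \<le> C * norm x"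
  shows "convergent_spectrum A"
  unfolding convergent_spectrum_def
proof (intro conjI allI impI)
  fix z assume z: "A *v (A *v z) = 0"
  have it: "((*v) (id_matrix + \<tau> *\<^sub>R A) ^^ k) z = z + (real k * \<tau>) *\<^sub>R (A *v z)" for k
  proof (induction k)
    case (Suc k)
    have "A *v (z + (real k * \<tau>) *\<^sub>R (A *v z)) = A *v z"
      by (simp only: matrix_vector_right_distrib matrix_vector_mult_scaleR z scaleR_zero_right add_0_right)
    hence "(id_matrix + \<tau> *\<^sub>R A) *v (z + (real k * \<tau>) *\<^sub>R (A *v z))
        = (z + (real k * \<tau>) *\<^sub>R (A *v z)) + \<tau> *\<^sub>R (A *v z)"
      by (simp only: euler_mult)
    also have "\<dots> = z + (real (Suc k) * \<tau>) *\<^sub>R (A *v z)"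
      by (simp add: scaleR_add_left distrib_right)
    finally show ?case by (simp only: funpow.simps comp_apply Suc)
  qed simp
  show "A *v z = 0"
  proof (rule ccontr)
    assume nz: "A *v z \<noteq> 0"
    obtain k :: nat where k: "real k > (C * norm z + norm z) / (\<tau> * norm (A *v z))"
      using reals_Archimedean2 by blast
    have "real k * \<tau> * norm (A *v z) \<le> norm (z + (real k * \<tau>) *\<^sub>R (A *v z)) + norm z"
      using norm_triangle_ineq4[of "z + (real k * \<tau>) *\<^sub>R (A *v z)" z] \<tau> by simp
    also have "\<dots> \<le> C * norm z + norm z" using bd[of k z] by (simp add: it)
    finally show False using k nz \<tau> by (simp add: field_simps)
  qed
next
  fix \<mu> v assume v: "v \<noteq> 0 \<and> complexify A *v v = \<mu> *s v"
  define l where "l = 1 + of_real \<tau> * \<mu>"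
  obtain d where d: "\<And>r. \<bar>r\<bar> \<le> norm (re_slice (of_real r * d) v)"
    using re_slice_expansive v by blast
  have "norm l ^ k \<le> \<bar>C\<bar> * (norm d * norm v)" for k
  proof -
    \<comment> \<open>With this phase the parameter after \<open>k\<close> steps is the positive multiple \<open>|l|\<^sup>k\<close> of \<open>d\<close>.\<close>
    define c where "c = d * cnj (sgn (l ^ k))"
    have rot: "c * l ^ k = of_real (norm l ^ k) * d"
    proof -
      have "c * l ^ k = d * (cnj (sgn (l ^ k)) * l ^ k)" by (simp add: c_def mult.assoc)
      also have "\<dots> = d * of_real (norm (l ^ k))" by (simp only: cnj_sgn_mult)
      finally show ?thesis by (simp add: norm_power mult.commute)
    qed
    have "norm l ^ k \<le> norm (re_slice (of_real (norm l ^ k) * d) v)"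
      using d[of "norm l ^ k"] by simp
    also have "\<dots> = norm (((*v) (id_matrix + \<tau> *\<^sub>R A) ^^ k) (re_slice c v))"
      using v by (simp add: funpow_euler_re_slice rot flip: l_def)
    also have "\<dots> \<le> C * norm (re_slice c v)" by (rule bd)
    also have "\<dots> \<le> \<bar>C\<bar> * norm (re_slice c v)" by (simp add: mult_right_mono)
    also have "norm (re_slice c v) \<le> norm c * norm v" by (rule norm_re_slice_le)
    also have "norm c \<le> norm d" by (simp add: c_def norm_mult norm_sgn)
    finally show ?thesis by (simp add: mult_left_mono mult_right_mono)
  qed
  hence "norm l \<le> 1"
    using real_arch_pow[of "norm l" "\<bar>C\<bar> * (norm d * norm v)"] by (meson leI not_le)
  hence "(norm l)\<^sup>2 \<le> 1" by (simp add: power_le_one)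
  hence "\<tau> * (2 * Re \<mu> + \<tau> * ((Re \<mu>)\<^sup>2 + (Im \<mu>)\<^sup>2)) \<le> 0"
    unfolding l_def cmod_power2 by (simp add: power2_eq_square algebra_simps)
  hence le: "2 * Re \<mu> + \<tau> * ((Re \<mu>)\<^sup>2 + (Im \<mu>)\<^sup>2) \<le> 0"
    using \<tau> by (simp add: mult_le_0_iff)
  have "\<tau> * ((Re \<mu>)\<^sup>2 + (Im \<mu>)\<^sup>2) > 0" if "\<mu> \<noteq> 0"
    using \<tau> that by (simp add: complex_eq_iff sum_power2_gt_zero_iff)
  with le show "\<mu> = 0 \<or> Re \<mu> < 0" by force
qed

lemma euler_convergent_imp_spectrum:
  fixes A :: "real^'n^'n"
  assumes \<tau>: "\<tau> > 0" and conv: "dt_convergent (id_matrix + \<tau> *\<^sub>R A)"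
  shows "convergent_spectrum A"
proof -
  define M where "M = id_matrix + \<tau> *\<^sub>R A"
  have "\<exists>B. \<forall>k. norm (((*v) M ^^ k) (axis i 1)) \<le> B" for i
  proof -
    have "convergent (\<lambda>k. ((*v) M ^^ k) (axis i 1))"
      using conv by (simp add: dt_convergent_iff M_def)
    from convergent_imp_Bseq[OF this] show ?thesis by (auto simp: Bseq_def)
  qed
  then obtain B where B: "\<And>i k. norm (((*v) M ^^ k) (axis i 1)) \<le> B i" by metis
  have "norm (((*v) M ^^ k) x) \<le> (\<Sum>i\<in>UNIV. B i) * norm x" for k x
  proof -
    have "norm (((*v) M ^^ k) x) \<le> (\<Sum>i\<in>UNIV. norm (((*v) M ^^ k) (axis i 1))) * norm x"
      by (rule linear_norm_le_axis_sum[OF funpow_matrix_linear])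
    also have "\<dots> \<le> (\<Sum>i\<in>UNIV. B i) * norm x"
      by (intro mult_right_mono sum_mono B) simp
    finally show ?thesis .
  qed
  thus ?thesis using power_bounded_euler_imp_spectrum[OF \<tau>] by (metis M_def)
qed

text \<open>Covers norm-like gauges (degree \<open>1\<close>, not necessarily symmetric) and quadratic forms
  (degree \<open>2\<close>).\<close>

definition pos_homogeneous :: "nat \<Rightarrow> (real^'n \<Rightarrow> real) \<Rightarrow> bool" where
  "pos_homogeneous d g \<longleftrightarrow> continuous_on UNIV g \<and> g 0 = 0 \<and> (\<forall>x. x \<noteq> 0 \<longrightarrow> g x > 0) \<and>
     (\<forall>r>0. \<forall>x. g (r *\<^sub>R x) = r ^ d * g x)"

text \<open>Extreme values on the unit sphere, extended by homogeneity.\<close>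

lemma pos_homogeneous_bounds:
  fixes g :: "real^'n \<Rightarrow> real"
  assumes g: "pos_homogeneous d g" and d: "d \<ge> 1"
  obtains a b where "a > 0" "\<And>x. a * norm x ^ d \<le> g x" "\<And>x. g x \<le> b * norm x ^ d"
proof -
  have c: "continuous_on (sphere 0 1) g"
    using g continuous_on_subset unfolding pos_homogeneous_def by blast
  have ne: "sphere (0::real^'n) 1 \<noteq> {}" by simp
  obtain u where u: "norm u = 1" "\<And>x. norm x = 1 \<Longrightarrow> g u \<le> g x"
    using continuous_attains_inf[OF compact_sphere ne c] by auto
  obtain w where w: "norm w = 1" "\<And>x. norm x = 1 \<Longrightarrow> g x \<le> g w"
    using continuous_attains_sup[OF compact_sphere ne c] by auto
  have eq: "g x = norm x ^ d * g (x /\<^sub>R norm x)" if "x \<noteq> 0" for x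
  proof -
    have "g (norm x *\<^sub>R (x /\<^sub>R norm x)) = norm x ^ d * g (x /\<^sub>R norm x)"
      using g that unfolding pos_homogeneous_def by (metis zero_less_norm_iff)
    thus ?thesis using that by simp
  qed
  have n1: "norm (x /\<^sub>R norm x) = 1" if "x \<noteq> 0" for x using that by simp
  show thesis
  proof
    show "g u > 0" using g u(1) unfolding pos_homogeneous_def by (metis norm_zero zero_neq_one)
    show "g u * norm x ^ d \<le> g x" "g x \<le> g w * norm x ^ d" for x
    proof -
      have "g u * norm x ^ d \<le> g x \<and> g x \<le> g w * norm x ^ d"
      proof (cases "x = 0")
        case True
        thus ?thesis using g d by (simp add: pos_homogeneous_def power_0_left)
      next
        case False
        thus ?thesis unfolding eq[OF False]
          using u(2)[OF n1[OF False]] w(2)[OF n1[OF False]]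
          by (subst (1 2) mult.commute) (simp only: mult_left_mono zero_le_power norm_ge_zero)
      qed
      thus "g u * norm x ^ d \<le> g x" "g x \<le> g w * norm x ^ d" by auto
    qed
  qed
qed

text \<open>A Lyapunov function of an Euler step is comparable with a power of the norm, so the step has
  bounded powers.\<close>

lemma nonexpansive_euler_imp_spectrum:
  fixes A :: "real^'n^'n"
  assumes g: "pos_homogeneous d g" and d: "d \<ge> 1" and \<tau>: "\<tau> > 0"
    and le: "\<And>x. g (x + \<tau> *\<^sub>R (A *v x)) \<le> g x"
  shows "convergent_spectrum A"
proof -
  obtain a b where ab: "a > 0" "\<And>x. a * norm x ^ d \<le> g x" "\<And>x. g x \<le> b * norm x ^ d"
    using pos_homogeneous_bounds[OF g d] by blast
  define C where "C = max 1 (b / a)"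
  have it: "g (((*v) (id_matrix + \<tau> *\<^sub>R A) ^^ k) x) \<le> g x" for k x
    by (induction k) (auto simp: euler_mult intro: order.trans[OF le])
  have "norm (((*v) (id_matrix + \<tau> *\<^sub>R A) ^^ k) x) \<le> C * norm x" (is "norm ?y \<le> _") for k x
  proof (rule power_le_imp_le_base[of _ "d - 1"])
    have "a * norm ?y ^ d \<le> b * norm x ^ d" using ab(2)[of ?y] ab(3)[of x] it[of k x] by linarith
    hence "norm ?y ^ d \<le> (b / a) * norm x ^ d" using ab(1) by (simp add: field_simps)
    also have "b / a \<le> C" by (simp add: C_def)
    also have "C \<le> C ^ d" using d by (intro self_le_power) (auto simp: C_def)
    finally show "norm ?y ^ Suc (d - 1) \<le> (C * norm x) ^ Suc (d - 1)"
      using d by (simp add: power_mult_distrib mult_right_mono)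
    show "0 \<le> C * norm x" by (simp add: C_def)
  qed
  thus ?thesis by (rule power_bounded_euler_imp_spectrum[OF \<tau>])
qed

section \<open>Convergent and stable continuous-time systems\<close>

lemma matrix_inv_mult:
  assumes "invertible N"
  shows "N ** matrix_inv N = Finite_Cartesian_Product.mat 1" "matrix_inv N ** N = Finite_Cartesian_Product.mat 1"
  using assms someI_ex[of "\<lambda>B. N ** B = Finite_Cartesian_Product.mat 1 \<and> B ** N = Finite_Cartesian_Product.mat 1"]
  unfolding invertible_def matrix_inv_def by auto

lemma norm_unbounded_ray:
  fixes z w :: "'a::real_normed_vector"
  assumes "\<And>t. t \<ge> 0 \<Longrightarrow> norm (z + t *\<^sub>R w) \<le> B"
  shows "w = 0"
proof (rule ccontr)
  assume nz: "w \<noteq> 0"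
  have B: "norm z \<le> B" using assms[of 0] by simp
  define t where "t = (2 * B + 1) / norm w"
  have t: "t \<ge> 0" using order.trans[OF norm_ge_zero B] by (simp add: t_def)
  have "norm (t *\<^sub>R w) \<le> norm (z + t *\<^sub>R w) + norm z"
    using norm_triangle_ineq4[of "z + t *\<^sub>R w" z] by simp
  also have "\<dots> \<le> 2 * B" using assms[OF t] B by simp
  finally show False using nz order.trans[OF norm_ge_zero B] by (simp add: t_def)
qed

lemma ct_solution_ray:
  assumes "A *v w = 0" "A *v z = w"
  shows "ct_solution A (\<lambda>t. z + t *\<^sub>R w)"
  unfolding ct_solution_def
proof (intro allI impI)
  fix t :: real
  have "A *v (z + t *\<^sub>R w) = w"
    by (simp only: matrix_vector_right_distrib matrix_vector_mult_scaleR assms scaleR_zero_right add_0_right)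
  moreover have "((\<lambda>t. z + t *\<^sub>R w) has_vector_derivative w) (at t within {0..})"
    by (auto intro!: derivative_eq_intros)
  ultimately show "((\<lambda>t. z + t *\<^sub>R w) has_vector_derivative A *v (z + t *\<^sub>R w)) (at t within {0..})"
    by simp
qed

lemma ct_solution_re_slice:
  assumes "complexify A *v v = \<mu> *s v"
  shows "ct_solution A (\<lambda>t. re_slice (c * exp (of_real t * \<mu>)) v)"
  unfolding ct_solution_def
proof (intro allI impI)
  fix t :: real
  have lin: "bounded_linear (\<lambda>c. re_slice c v)"
    by (rule bounded_linear_intro[where K = "norm v"])
      (simp_all add: re_slice_add re_slice_scaleR norm_re_slice_le)
  have "((\<lambda>t. c * exp (of_real t * \<mu>)) has_vector_derivative c * exp (of_real t * \<mu>) * \<mu>) (at t within {0..})"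
    by (rule has_vector_derivative_real_field) (auto intro!: derivative_eq_intros)
  from bounded_linear.has_vector_derivative[OF lin this]
  show "((\<lambda>t. re_slice (c * exp (of_real t * \<mu>)) v) has_vector_derivative
      A *v re_slice (c * exp (of_real t * \<mu>)) v) (at t within {0..})"
    by (simp add: matrix_mult_re_slice assms re_slice_smult)
qed

text \<open>A nonzero limit would be invariant under every time shift, so the exponential would be constant.\<close>

lemma exp_convergent_imp:
  fixes \<mu> L :: complex
  assumes lim: "((\<lambda>t. exp (of_real t * \<mu>)) \<longlongrightarrow> L) at_top"
  shows "\<mu> = 0 \<or> Re \<mu> < 0"
proof (cases "L = 0")
  case True
  have "((\<lambda>t. norm (exp (of_real t * \<mu>))) \<longlongrightarrow> 0) at_top"
    using tendsto_norm[OF lim] True by simp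
  hence "eventually (\<lambda>t. norm (exp (of_real t * \<mu>)) < 1) at_top"
    by (rule order_tendstoD) simp
  hence "eventually (\<lambda>t. t > 0 \<and> t * Re \<mu> < 0) at_top"
    using eventually_gt_at_top[of 0] by eventually_elim simp
  then obtain t where "t > 0" "t * Re \<mu> < 0"
    using eventually_happens'[OF trivial_limit_at_top_linorder] by blast
  thus ?thesis by (simp add: mult_less_0_iff)
next
  case False
  have "exp (of_real s * \<mu>) = 1" for s :: real
  proof -
    have "filterlim (\<lambda>t. s + t) at_top at_top"
      by (rule filterlim_tendsto_add_at_top[OF tendsto_const filterlim_ident])
    hence "((\<lambda>t. exp (of_real (s + t) * \<mu>)) \<longlongrightarrow> L) at_top"
      by (rule filterlim_compose[OF lim])
    moreover have "((\<lambda>t. exp (of_real (s + t) * \<mu>)) \<longlongrightarrow> L * exp (of_real s * \<mu>)) at_top"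
    proof -
      have "exp (of_real (s + t) * \<mu>) = exp (of_real t * \<mu>) * exp (of_real s * \<mu>)" for t
        by (simp add: exp_add distrib_right add.commute flip: exp_add)
      thus ?thesis by (simp only:) (intro tendsto_intros lim)
    qed
    ultimately have "L = L * exp (of_real s * \<mu>)"
      by (rule tendsto_unique[OF trivial_limit_at_top_linorder])
    thus ?thesis using False by simp
  qed
  hence "((\<lambda>s. exp (of_real s * \<mu>)) has_vector_derivative 0) (at 0)" by simp
  moreover have "((\<lambda>s. exp (of_real s * \<mu>)) has_vector_derivative \<mu>) (at 0)"
    by (rule has_vector_derivative_real_field) (auto intro!: derivative_eq_intros)
  ultimately have "\<mu> = 0" using vector_derivative_unique_at by blast
  thus ?thesis by simp
qed

lemma ct_convergent_imp_spectrum: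
  assumes "ct_convergent A"
  shows "convergent_spectrum A"
  unfolding convergent_spectrum_def
proof (intro conjI allI impI)
  have conv: "\<exists>l. (x \<longlongrightarrow> l) at_top" if "ct_solution A x" for x
    using assms that unfolding ct_convergent_def by blast
  fix z assume z: "A *v (A *v z) = 0"
  from conv[OF ct_solution_ray[OF z refl]] obtain l
    where l: "((\<lambda>t. z + t *\<^sub>R (A *v z)) \<longlongrightarrow> l) at_top" by blast
  have "((\<lambda>t. inverse t *\<^sub>R (z + t *\<^sub>R (A *v z))) \<longlongrightarrow> 0 *\<^sub>R l) at_top"
    by (intro tendsto_scaleR l tendsto_inverse_0_at_top filterlim_ident)
  moreover have "((\<lambda>t. inverse t *\<^sub>R z + A *v z) \<longlongrightarrow> 0 *\<^sub>R z + A *v z) at_top"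
    by (intro tendsto_add tendsto_scaleR tendsto_const tendsto_inverse_0_at_top filterlim_ident)
  moreover have "eventually (\<lambda>t. inverse t *\<^sub>R (z + t *\<^sub>R (A *v z)) = inverse t *\<^sub>R z + A *v z) at_top"
    using eventually_gt_at_top[of 0]
    by eventually_elim (simp add: scaleR_add_right)
  ultimately show "A *v z = 0"
    using tendsto_unique[OF trivial_limit_at_top_linorder] tendsto_cong by fastforce
next
  fix \<mu> v assume v: "v \<noteq> 0 \<and> complexify A *v v = \<mu> *s v"
  then obtain i where i: "v $ i \<noteq> 0" by (auto simp: vec_eq_iff)
  have conv: "\<exists>l. ((\<lambda>t. Re (c * exp (of_real t * \<mu>) * v $ i)) \<longlongrightarrow> l) at_top" for c
  proof -
    have "ct_solution A (\<lambda>t. re_slice (c * exp (of_real t * \<mu>)) v)"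
      by (rule ct_solution_re_slice) (use v in simp)
    then obtain l where "((\<lambda>t. re_slice (c * exp (of_real t * \<mu>)) v) \<longlongrightarrow> l) at_top"
      using assms unfolding ct_convergent_def by blast
    from tendsto_vec_nth[OF this, of i] show ?thesis by (auto simp: re_slice_def)
  qed
  obtain p where "((\<lambda>t. Re (1 * exp (of_real t * \<mu>) * v $ i)) \<longlongrightarrow> p) at_top" using conv by blast
  moreover obtain q where "((\<lambda>t. Re (- \<i> * exp (of_real t * \<mu>) * v $ i)) \<longlongrightarrow> q) at_top" using conv by blast
  ultimately have "((\<lambda>t. Complex (Re (exp (of_real t * \<mu>) * v $ i)) (Im (exp (of_real t * \<mu>) * v $ i))) \<longlongrightarrow> Complex p q) at_top"
    by (intro tendsto_Complex) (simp_all add: algebra_simps)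
  hence "((\<lambda>t. exp (of_real t * \<mu>) * v $ i / v $ i) \<longlongrightarrow> Complex p q / v $ i) at_top"
    by (intro tendsto_divide tendsto_const i) (simp only: complex.collapse)
  hence "((\<lambda>t. exp (of_real t * \<mu>)) \<longlongrightarrow> Complex p q / v $ i) at_top"
    using i by simp
  thus "\<mu> = 0 \<or> Re \<mu> < 0" by (rule exp_convergent_imp)
qed

lemma ct_stable_kernel:
  assumes "ct_stable B" and z: "B *v (B *v z) = 0"
  shows "B *v z = 0"
proof -
  from assms(1)[unfolded ct_stable_def, rule_format, of 1] obtain \<delta>
    where \<delta>: "\<delta> > 0" "\<And>x t. \<lbrakk>ct_solution B x; norm (x 0) < \<delta>; t \<ge> 0\<rbrakk> \<Longrightarrow> norm (x t) < 1"
    by auto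
  define r where "r = \<delta> / (norm z + 1)"
  have pos: "norm z + 1 > 0" using norm_ge_zero[of z] by linarith
  have r: "r > 0" using \<delta>(1) pos by (simp add: r_def)
  have small: "norm (r *\<^sub>R z) < \<delta>"
    using \<delta>(1) pos by (simp add: r_def field_simps)
  have "ct_solution B (\<lambda>t. r *\<^sub>R z + t *\<^sub>R (r *\<^sub>R (B *v z)))"
    by (rule ct_solution_ray) (simp_all only: matrix_vector_mult_scaleR z scaleR_zero_right)
  from \<delta>(2)[OF this] small have "norm (r *\<^sub>R z + t *\<^sub>R (r *\<^sub>R (B *v z))) \<le> 1" if "t \<ge> 0" for t
    using that by fastforce
  hence "r *\<^sub>R (B *v z) = 0" by (rule norm_unbounded_ray)
  thus ?thesis using r by simp
qed

text \<open>An initial state small enough for stability is chosen, and then a time at which the growth of the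
  exponential would overcome that smallness.\<close>

lemma ct_stable_eigenvalue:
  assumes "ct_stable B" and v: "v \<noteq> 0" "complexify B *v v = \<nu> *s v"
  shows "Re \<nu> \<le> 0"
proof (rule ccontr)
  assume neg: "\<not> Re \<nu> \<le> 0"
  from assms(1)[unfolded ct_stable_def, rule_format, of 1] obtain \<delta>
    where \<delta>: "\<delta> > 0" "\<And>x t. \<lbrakk>ct_solution B x; norm (x 0) < \<delta>; t \<ge> 0\<rbrakk> \<Longrightarrow> norm (x t) < 1"
    by auto
  obtain d where d: "\<And>r. \<bar>r\<bar> \<le> norm (re_slice (of_real r * d) v)"
    using re_slice_expansive v by blast
  define r where "r = \<delta> / (norm d * norm v + 1)"
  have pos: "norm d * norm v + 1 > 0" by (smt (verit) mult_nonneg_nonneg norm_ge_zero)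
  have r: "r > 0" using \<delta>(1) pos by (simp add: r_def)
  \<comment> \<open>The time at which the real growth factor is \<open>exp (1 / r)\<close>, which exceeds \<open>1 / r\<close>.\<close>
  define t where "t = inverse r / Re \<nu>"
  have t: "t \<ge> 0" using r neg by (simp add: t_def)
  define w where "w = exp (of_real t * \<nu>)"
  define c where "c = of_real r * d * cnj (sgn w)"
  have "norm (re_slice c v) \<le> norm c * norm v" by (rule norm_re_slice_le)
  also have "norm c * norm v \<le> r * (norm d * norm v)"
    using r by (simp add: c_def norm_mult norm_sgn w_def)
  also have "\<dots> < \<delta>" using \<delta>(1) pos by (simp add: r_def field_simps)
  finally have small: "norm (re_slice c v) < \<delta>" .
  have "norm (re_slice (c * w) v) < 1"
    using \<delta>(2)[OF ct_solution_re_slice[OF v(2), of c] _ t] small by (simp add: w_def)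
  moreover have "c * w = of_real (r * norm w) * d"
  proof -
    have "c * w = of_real r * d * (cnj (sgn w) * w)" by (simp add: c_def mult.assoc)
    thus ?thesis by (simp add: cnj_sgn_mult)
  qed
  ultimately have "r * norm w < 1" using d[of "r * norm w"] by simp
  moreover have "norm w = exp (inverse r)"
  proof -
    have "t * Re \<nu> = inverse r" using neg by (simp add: t_def)
    thus ?thesis by (simp add: w_def)
  qed
  moreover have "r * exp (inverse r) \<ge> r * (1 + inverse r)"
    using r by (intro mult_left_mono exp_ge_add_one_self) auto
  ultimately show False using r by (simp add: distrib_left)
qed

text \<open>With \<open>N = I + \<epsilon> A\<close> and \<open>B = A N\<^sup>-\<^sup>1\<close> one has \<open>B N = A\<close>, so eigenvectors of
  \<open>A\<close> are eigenvectors of \<open>B\<close> for \<open>\<mu> / (1 + \<epsilon> \<mu>)\<close>, and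
  \<open>Re (\<mu> (1 + \<epsilon> \<mu>)\<^sup>*) = Re \<mu> + \<epsilon> |\<mu>|\<^sup>2\<close>. Likewise \<open>N\<close> fixes the kernel of
  \<open>A\<close>, so a Jordan chain of \<open>A\<close> at \<open>0\<close> becomes one of \<open>B\<close>.\<close>

lemma stable_imp_spectrum:
  fixes A :: "real^'n^'n"
  assumes \<epsilon>: "\<epsilon> > 0" and inv: "invertible (id_matrix + \<epsilon> *\<^sub>R A)"
    and st: "ct_stable (A ** matrix_inv (id_matrix + \<epsilon> *\<^sub>R A))"
  shows "convergent_spectrum A"
proof -
  define N where "N = id_matrix + \<epsilon> *\<^sub>R A"
  define B where "B = A ** matrix_inv N"
  have BN: "B ** N = A"
    using matrix_inv_mult(2)[OF inv] unfolding B_def N_def by (simp flip: matrix_mul_assoc)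
  hence BNv: "B *v (N *v x) = A *v x" for x by (simp add: matrix_vector_mul_assoc)
  have st: "ct_stable B" using st by (simp add: B_def N_def)
  have Nv: "N *v x = x + \<epsilon> *\<^sub>R (A *v x)" for x by (simp add: N_def euler_mult)
  show ?thesis
    unfolding convergent_spectrum_def
  proof (intro conjI allI impI)
    fix z assume z: "A *v (A *v z) = 0"
    have "N *v (A *v z) = A *v z" by (simp only: Nv z scaleR_zero_right add_0_right)
    hence "B *v (B *v (N *v z)) = 0" using BNv[of "A *v z"] z by (simp add: BNv)
    from ct_stable_kernel[OF st this] show "A *v z = 0" by (simp add: BNv)
  next
    fix \<mu> v assume v: "v \<noteq> 0 \<and> complexify A *v v = \<mu> *s v"
    define l where "l = 1 + of_real \<epsilon> * \<mu>"
    have N: "complexify N *v v = l *s v"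
      using v unfolding N_def complexify_euler
      by (simp add: l_def vec.scale_left_distrib vector_smult_assoc)
    have "l \<noteq> 0"
    proof
      assume "l = 0"
      have "re_slice c v = 0" for c
      proof -
        have "N *v re_slice c v = 0" using N \<open>l = 0\<close>
          by (simp add: matrix_mult_re_slice) (simp add: re_slice_def vec_eq_iff)
        thus ?thesis using matrix_inv_mult(2)[OF inv]
          by (metis N_def matrix_vector_mul_assoc matrix_vector_mul_lid matrix_vector_mult_0_right)
      qed
      thus False using v re_slice_eq_0_imp by blast
    qed
    have "l *s (complexify B *v v) = \<mu> *s v"
      using v N BN complexify_mult[of B N]
      by (metis matrix_vector_mul_assoc vector_scalar_commute)
    hence "inverse l *s (l *s (complexify B *v v)) = (\<mu> / l) *s v"
      by (simp add: vector_smult_assoc field_simps)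
    hence "complexify B *v v = (\<mu> / l) *s v" using \<open>l \<noteq> 0\<close> by (simp add: vector_smult_assoc)
    from ct_stable_eigenvalue[OF st _ this] v have "Re (\<mu> / l) \<le> 0" by blast
    hence "Re (\<mu> * cnj l) \<le> 0" by (simp only: Re_complex_div_le_0)
    hence le: "Re \<mu> + \<epsilon> * ((Re \<mu>)\<^sup>2 + (Im \<mu>)\<^sup>2) \<le> 0"
      by (simp add: l_def power2_eq_square algebra_simps)
    have "\<epsilon> * ((Re \<mu>)\<^sup>2 + (Im \<mu>)\<^sup>2) > 0" if "\<mu> \<noteq> 0"
      using \<epsilon> that by (simp add: complex_eq_iff sum_power2_gt_zero_iff)
    with le show "\<mu> = 0 \<or> Re \<mu> < 0" by force
  qed
qed

section \<open>Quadratic Lyapunov functions\<close>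

lemma transpose_add: "transpose (X + Y) = transpose X + transpose Y"
  by (simp add: vec_eq_iff transpose_def)

lemma inner_transpose_matrix: "x \<bullet> (transpose A *v y) = (A *v x) \<bullet> y" for A :: "real^'n^'m"
  by (metis dot_lmul_matrix inner_commute transpose_matrix_vector)

lemma inner_symmetric_matrix:
  "transpose P = P \<Longrightarrow> x \<bullet> (P *v y) = (P *v x) \<bullet> y" for P :: "real^'n^'n"
  using inner_transpose_matrix[of x P y] by simp

lemma quadratic_form_add:
  fixes P :: "real^'n^'n"
  assumes "transpose P = P"
  shows "(x + y) \<bullet> (P *v (x + y)) = x \<bullet> (P *v x) + 2 * (y \<bullet> (P *v x)) + y \<bullet> (P *v y)"
proof -
  have "x \<bullet> (P *v y) = y \<bullet> (P *v x)"
    using inner_symmetric_matrix[OF assms] by (simp add: inner_commute)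
  thus ?thesis by (simp add: matrix_vector_right_distrib inner_add_left inner_add_right)
qed

text \<open>The common shape of the matrix inequalities in (f) and (g), read as an inequality between
  quadratic forms.\<close>

lemma lyapunov_inequality_iff:
  fixes A P Q :: "real^'n^'n"
  assumes P: "transpose P = P" and Q: "transpose Q = Q"
  shows "pos_semidef (- (transpose A ** P + P ** A + transpose A ** Q ** A)) \<longleftrightarrow>
    (\<forall>x. 2 * ((A *v x) \<bullet> (P *v x)) + (A *v x) \<bullet> (Q *v (A *v x)) \<le> 0)"
proof -
  let ?L = "transpose A ** P + P ** A + transpose A ** Q ** A"
  have t2: "transpose (- X) = - transpose X" for X :: "real^'n^'n"
    by (simp add: vec_eq_iff transpose_def)
  have "transpose ?L = ?L"
    by (simp add: transpose_add matrix_transpose_mul P Q matrix_mul_assoc)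
  hence "transpose (- ?L) = - ?L" by (simp only: t2)
  moreover have "x \<bullet> ((- ?L) *v x) = - (2 * ((A *v x) \<bullet> (P *v x)) + (A *v x) \<bullet> (Q *v (A *v x)))" for x
  proof -
    have neg: "(- B) *v x = - (B *v x)" for B :: "real^'n^'n"
      by (simp add: vec_eq_iff matrix_vector_mult_def sum_negf)
    have "x \<bullet> (?L *v x) = x \<bullet> (transpose A *v (P *v x)) + x \<bullet> (P *v (A *v x))
        + x \<bullet> (transpose A *v (Q *v (A *v x)))"
      by (simp add: matrix_vector_mult_add_rdistrib inner_add_right del: transpose_matrix_vector
          flip: matrix_vector_mul_assoc)
    also have "\<dots> = 2 * ((A *v x) \<bullet> (P *v x)) + (A *v x) \<bullet> (Q *v (A *v x))"
      using inner_symmetric_matrix[OF P, of x "A *v x"]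
      unfolding inner_transpose_matrix by (simp add: inner_commute)
    finally show ?thesis unfolding neg by simp
  qed
  ultimately show ?thesis
    unfolding pos_semidef_def by (simp only: neg_0_le_iff_le simp_thms)
qed

lemma pos_homogeneous_quadratic_form:
  assumes "pos_def P"
  shows "pos_homogeneous 2 (\<lambda>x. x \<bullet> (P *v x))"
proof -
  have "continuous_on UNIV (\<lambda>x. x \<bullet> (P *v x))"
    by (intro continuous_on_inner continuous_on_id linear_continuous_on matrix_vector_mul_bounded_linear)
  thus ?thesis using assms
    by (simp add: pos_homogeneous_def pos_def_def matrix_vector_mult_scaleR power2_eq_square)
qed

lemma pos_def_form_nonneg: "pos_def P \<Longrightarrow> y \<bullet> (P *v y) \<ge> 0"
  by (cases "y = 0") (auto simp: pos_def_def less_imp_le)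

text \<open>Derivatives are one-sided at \<open>0\<close>, as they are for solutions on the half-line.\<close>

lemma nonincreasing_from_derivative:
  fixes h :: "real \<Rightarrow> real"
  assumes "\<And>t. t \<ge> 0 \<Longrightarrow> (h has_real_derivative h' t) (at t within {0..})"
    and "\<And>t. t \<ge> 0 \<Longrightarrow> h' t \<le> 0" and "t \<ge> 0"
  shows "h t \<le> h 0"
proof (cases "t = 0")
  case False
  with assms(3) have t: "0 < t" by simp
  have "\<And>s. \<lbrakk>0 \<le> s; s \<le> t\<rbrakk> \<Longrightarrow> (h has_derivative (*) (h' s)) (at s within {0..t})"
    by (rule has_derivative_subset[OF assms(1)[unfolded has_field_derivative_def]]) auto
  from mvt_simple[OF t this] obtain s where "s \<in> {0<..<t}" "h t - h 0 = h' s * t"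
    by auto
  thus ?thesis using assms(2)[of s] mult_nonpos_nonneg[of "h' s" t] t by force
qed simp

text \<open>The additional factor \<open>B\<close> makes the lemma apply both to the state
  (\<open>B = I\<close>) and to its velocity (\<open>B = A\<close>).\<close>

lemma ct_solution_quadratic_form_derivative:
  fixes A B :: "real^'n^'n"
  assumes P: "transpose P = P" and x: "ct_solution A x" and t: "t \<ge> 0"
  shows "((\<lambda>t. (B *v x t) \<bullet> (P *v (B *v x t))) has_real_derivative
           2 * ((B *v (A *v x t)) \<bullet> (P *v (B *v x t)))) (at t within {0..})"
proof -
  have lin: "bounded_linear ((*v) C)" for C :: "real^'n^'n" by (rule matrix_vector_mul_bounded_linear)
  have 1: "(x has_vector_derivative A *v x t) (at t within {0..})"
    using x t by (simp add: ct_solution_def)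
  note 2 = bounded_linear.has_vector_derivative[OF lin 1, of B]
  note 3 = bounded_linear.has_vector_derivative[OF lin 2, of P]
  have "((\<lambda>t. (B *v x t) \<bullet> (P *v (B *v x t))) has_vector_derivative
      (B *v x t) \<bullet> (P *v (B *v (A *v x t))) + (B *v (A *v x t)) \<bullet> (P *v (B *v x t))) (at t within {0..})"
    by (rule bounded_bilinear.has_vector_derivative[OF bounded_bilinear_inner 2 3])
  moreover have "(B *v x t) \<bullet> (P *v (B *v (A *v x t))) = (B *v (A *v x t)) \<bullet> (P *v (B *v x t))"
    using inner_symmetric_matrix[OF P] by (simp add: inner_commute)
  ultimately show ?thesis by (simp add: has_real_derivative_iff_has_vector_derivative)
qed

text \<open>Condition (f) in terms of quadratic forms. The term with \<open>\<epsilon>\<close> is the decay rate that a weak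
  quadratic Lyapunov function lacks.\<close>

definition dissipative :: "real \<Rightarrow> real^'n^'n \<Rightarrow> real^'n^'n \<Rightarrow> bool" where
  "dissipative \<epsilon> P A \<longleftrightarrow> \<epsilon> > 0 \<and> pos_def P \<and>
     (\<forall>x. 2 * ((A *v x) \<bullet> (P *v x)) + \<epsilon> * ((A *v x) \<bullet> (P *v (A *v x))) \<le> 0)"

lemma dissipative_iff_lyapunov_inequality:
  fixes A :: "real^'n^'n"
  shows "dissipative \<epsilon> P A \<longleftrightarrow> \<epsilon> > 0 \<and> pos_def P \<and>
     pos_semidef (- (transpose A ** P + P ** A + \<epsilon> *\<^sub>R (transpose A ** P ** A)))"
proof -
  have eq: "\<epsilon> *\<^sub>R (transpose A ** P ** A) = transpose A ** (\<epsilon> *\<^sub>R P) ** A"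
    by (simp add: matrix_scalar_ac scalar_matrix_assoc)
  show ?thesis
    unfolding eq dissipative_def
    using lyapunov_inequality_iff[of P "\<epsilon> *\<^sub>R P" A]
    by (auto simp: pos_def_def transpose_scalar scaleR_matrix_vector_assoc[symmetric])
qed

lemma euler_quadratic_form:
  fixes A P :: "real^'n^'n"
  assumes "transpose P = P"
  shows "(x + \<tau> *\<^sub>R (A *v x)) \<bullet> (P *v (x + \<tau> *\<^sub>R (A *v x))) = x \<bullet> (P *v x) +
    \<tau> * (2 * ((A *v x) \<bullet> (P *v x)) + \<tau> * ((A *v x) \<bullet> (P *v (A *v x))))"
  unfolding quadratic_form_add[OF assms] by (simp add: matrix_vector_mult_scaleR algebra_simps)

lemma dissipative_imp_spectrum:
  assumes "dissipative \<epsilon> P A"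
  shows "convergent_spectrum A"
proof (rule nonexpansive_euler_imp_spectrum)
  from assms have \<epsilon>: "\<epsilon> > 0" and P: "pos_def P" and le:
     "\<And>x. 2 * ((A *v x) \<bullet> (P *v x)) + \<epsilon> * ((A *v x) \<bullet> (P *v (A *v x))) \<le> 0"
    by (auto simp: dissipative_def)
  show "\<epsilon> > 0" by (rule \<epsilon>)
  show "pos_homogeneous 2 (\<lambda>x. x \<bullet> (P *v x))" using P by (rule pos_homogeneous_quadratic_form)
  show "(x + \<epsilon> *\<^sub>R (A *v x)) \<bullet> (P *v (x + \<epsilon> *\<^sub>R (A *v x))) \<le> x \<bullet> (P *v x)" for x
  proof -
    note euler_quadratic_form[of P x \<epsilon> A]
    moreover have "transpose P = P" using P by (simp add: pos_def_def)
    moreover have "\<epsilon> * (2 * ((A *v x) \<bullet> (P *v x)) + \<epsilon> * ((A *v x) \<bullet> (P *v (A *v x)))) \<le> 0"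
      using le[of x] \<epsilon> by (simp add: mult_nonneg_nonpos)
    ultimately show ?thesis by linarith
  qed
qed simp

text \<open>Write \<open>q\<close> for the quadratic form. Along a solution both \<open>q(x)\<close> and
  \<open>q(A x)\<close> are nonincreasing, the latter because \<open>A x\<close> is a solution again, and \<open>q(x)\<close>
  decreases at rate at least \<open>\<epsilon> q(A x)\<close>. Hence \<open>q(x) + \<epsilon> t q(A x)\<close> is nonincreasing, which
  bounds \<open>q(A x)\<close> by a multiple of \<open>1 / t\<close>. So \<open>A x(t)\<close> vanishes in the limit, while
  the kernel component of \<open>x(t)\<close> is constant.\<close>

theorem dissipative_imp_ct_convergent:
  fixes A :: "real^'n^'n"
  assumes "dissipative \<epsilon> P A"
  shows "ct_convergent A"
proof -
  from assms have \<epsilon>: "\<epsilon> > 0" and P: "pos_def P" and le: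
     "\<And>x. 2 * ((A *v x) \<bullet> (P *v x)) + \<epsilon> * ((A *v x) \<bullet> (P *v (A *v x))) \<le> 0"
    by (auto simp: dissipative_def)
  have sym: "transpose P = P" using P by (simp add: pos_def_def)
  have nonneg: "y \<bullet> (P *v y) \<ge> 0" for y
    by (rule pos_def_form_nonneg[OF P])
  have decr: "(A *v y) \<bullet> (P *v y) \<le> 0" for y
    using le[of y] mult_nonneg_nonneg[OF less_imp_le[OF \<epsilon>] nonneg[of "A *v y"]] by linarith
  obtain K L where KL: "\<And>x. A *v (K *v x) = 0" "\<And>x. K *v (A *v x) = 0"
    "\<And>x. x = K *v x + L *v (A *v x)"
    using group_inverse[of A] dissipative_imp_spectrum[OF assms] unfolding convergent_spectrum_def by metis
  obtain a where a: "a > 0" "\<And>y. a * norm y ^ 2 \<le> y \<bullet> (P *v y)"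
    using pos_homogeneous_bounds[OF pos_homogeneous_quadratic_form[OF P]] by (metis one_le_numeral)
  have "(x \<longlongrightarrow> K *v x 0) at_top" if x: "ct_solution A x" for x
  proof -
    let ?q = "\<lambda>t. x t \<bullet> (P *v x t)" and ?r = "\<lambda>t. (A *v x t) \<bullet> (P *v (A *v x t))"
    have dq: "(?q has_real_derivative 2 * ((A *v x t) \<bullet> (P *v x t))) (at t within {0..})" if "t \<ge> 0" for t
      using ct_solution_quadratic_form_derivative[OF sym x that, of id_matrix] by simp
    have dr: "(?r has_real_derivative 2 * ((A *v (A *v x t)) \<bullet> (P *v (A *v x t)))) (at t within {0..})"
      if "t \<ge> 0" for t
      using ct_solution_quadratic_form_derivative[OF sym x that, of A] .
    have bound: "\<epsilon> * t * ?r t \<le> ?q 0" if t: "t \<ge> 0" for t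
    proof -
      \<comment> \<open>Differentiating the weight \<open>\<epsilon> t\<close> produces exactly the term that the decay of \<open>?q\<close> pays for.\<close>
      let ?h = "\<lambda>t. ?q t + \<epsilon> * t * ?r t"
      let ?h' = "\<lambda>t. 2 * ((A *v x t) \<bullet> (P *v x t)) + (\<epsilon> * ?r t
          + \<epsilon> * t * (2 * ((A *v (A *v x t)) \<bullet> (P *v (A *v x t)))))"
      have "?h t \<le> ?h 0"
      proof (rule nonincreasing_from_derivative[where h' = ?h'])
        fix s :: real assume s: "s \<ge> 0"
        show "(?h has_real_derivative ?h' s) (at s within {0..})"
          by (rule derivative_eq_intros dq[OF s] dr[OF s] refl)+ simp
        have "\<epsilon> * s * (2 * ((A *v (A *v x s)) \<bullet> (P *v (A *v x s)))) \<le> 0"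
          using \<epsilon> s decr[of "A *v x s"] by (simp add: mult_nonneg_nonpos)
        thus "?h' s \<le> 0" using le[of "x s"] by linarith
      qed (rule t)
      thus ?thesis using nonneg[of "x t"] by simp
    qed
    have "((\<lambda>t. A *v x t) \<longlongrightarrow> 0) at_top"
    proof -
      have up: "eventually (\<lambda>t. norm (A *v x t) ^ 2 \<le> (?q 0 / (a * \<epsilon>)) * inverse t) at_top"
        using eventually_gt_at_top[of 0]
      proof eventually_elim
        case (elim t)
        have "\<epsilon> * t * (a * norm (A *v x t) ^ 2) \<le> \<epsilon> * t * ?r t"
          using a(2)[of "A *v x t"] \<epsilon> elim by (intro mult_left_mono) auto
        also have "\<dots> \<le> ?q 0" using bound elim by simp
        finally show ?case using \<epsilon> elim a(1) by (simp add: field_simps)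
      qed
      have "((\<lambda>t. (?q 0 / (a * \<epsilon>)) * inverse t) \<longlongrightarrow> 0) at_top"
        by (intro tendsto_mult_right_zero tendsto_inverse_0_at_top filterlim_ident)
      from tendsto_sandwich[OF _ up tendsto_const this]
      have "((\<lambda>t. norm (A *v x t) ^ 2) \<longlongrightarrow> 0) at_top" by simp
      from tendsto_real_sqrt[OF this] show ?thesis by (simp add: tendsto_norm_zero_iff)
    qed
    from bounded_linear.tendsto[OF matrix_vector_mul_bounded_linear this, of L]
    have lim: "((\<lambda>t. K *v x 0 + L *v (A *v x t)) \<longlongrightarrow> K *v x 0) at_top"
      by (auto intro: tendsto_eq_intros)
    have const: "K *v x t = K *v x 0" if t: "t \<ge> 0" for t
    proof -
      have "((\<lambda>t. K *v x t) has_vector_derivative 0) (at s within {0..})" if "s \<in> {0..}" for s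
        using bounded_linear.has_vector_derivative[OF matrix_vector_mul_bounded_linear, of x "A *v x s" "at s within {0..}" K]
          x that by (simp add: ct_solution_def KL(2))
      from has_vector_derivative_zero_constant[OF convex_real_interval(1) this]
      obtain c where "\<And>s. s \<in> {0..} \<Longrightarrow> K *v x s = c" by blast
      thus ?thesis using t by simp
    qed
    have "eventually (\<lambda>t. K *v x 0 + L *v (A *v x t) = x t) at_top"
      using eventually_ge_at_top[of 0] by eventually_elim (metis const KL(3))
    with lim show ?thesis by (rule Lim_transform_eventually)
  qed
  note conv = this
  show ?thesis
    unfolding ct_convergent_def
  proof
    fix x0
    show "\<exists>l. \<forall>x. ct_solution A x \<and> x 0 = x0 \<longrightarrow> (x \<longlongrightarrow> l) at_top"
      by (rule exI[of _ "K *v x0"]) (use conv in fastforce)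
  qed
qed

text \<open>Substituting \<open>x = y + \<delta> A y\<close> turns the derivative of the form along the modified system
  into \<open>A y \<bullet> P y + \<delta> A y \<bullet> P A y\<close>, which is nonpositive once \<open>2 \<delta> \<le> \<epsilon>\<close>. Invertibility
  of \<open>I + \<delta> A\<close> needs the strict inequality \<open>2 \<delta> < \<epsilon>\<close>.\<close>

theorem dissipative_imp_resolvent_stable:
  fixes A :: "real^'n^'n"
  assumes "dissipative \<epsilon> P A"
  shows "\<exists>\<delta>>0. invertible (id_matrix + \<delta> *\<^sub>R A) \<and> ct_stable (A ** matrix_inv (id_matrix + \<delta> *\<^sub>R A))"
proof -
  from assms have \<epsilon>: "\<epsilon> > 0" and P: "pos_def P" and le:
     "\<And>x. 2 * ((A *v x) \<bullet> (P *v x)) + \<epsilon> * ((A *v x) \<bullet> (P *v (A *v x))) \<le> 0"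
    by (auto simp: dissipative_def)
  have sym: "transpose P = P" using P by (simp add: pos_def_def)
  have nonneg: "y \<bullet> (P *v y) \<ge> 0" for y
    by (rule pos_def_form_nonneg[OF P])
  \<comment> \<open>Any value below \<open>\<epsilon> / 2\<close> would do.\<close>
  define \<delta> where "\<delta> = \<epsilon> / 4"
  have \<delta>: "\<delta> > 0" "\<epsilon> = 4 * \<delta>" using \<epsilon> by (auto simp: \<delta>_def)
  define N where "N = id_matrix + \<delta> *\<^sub>R A"
  have Nv: "N *v x = x + \<delta> *\<^sub>R (A *v x)" for x by (simp add: N_def euler_mult)
  have "y = 0" if "N *v y = 0" for y
  proof (rule ccontr)
    assume "y \<noteq> 0"
    have y: "y = - \<delta> *\<^sub>R (A *v y)" using that by (simp add: Nv eq_neg_iff_add_eq_0)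
    let ?b = "(A *v y) \<bullet> (P *v (A *v y))"
    have "(A *v y) \<bullet> (P *v y) = - \<delta> * ?b"
      by (subst (2) y) (simp only: matrix_vector_mult_scaleR inner_scaleR_right)
    hence "2 * \<delta> * ?b \<le> 0" using le[of y] \<delta>(2) by simp
    hence "?b \<le> 0" using \<delta>(1) by (simp add: mult_le_0_iff)
    hence "A *v y = 0" using P unfolding pos_def_def by (meson not_le)
    thus False using y \<open>y \<noteq> 0\<close> by simp
  qed
  hence inv: "invertible N"
    using matrix_left_invertible_ker[of N] invertible_left_inverse by blast
  define B where "B = A ** matrix_inv N"
  have diss: "(B *v x) \<bullet> (P *v x) \<le> 0" for x
  proof -
    define y where "y = matrix_inv N *v x"
    have x: "x = y + \<delta> *\<^sub>R (A *v y)"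
      using matrix_inv_mult(1)[OF inv] Nv[of y] by (simp add: y_def matrix_vector_mul_assoc)
    have "B *v x = A *v y" by (simp add: B_def y_def matrix_vector_mul_assoc)
    hence "(B *v x) \<bullet> (P *v x) = (A *v y) \<bullet> (P *v y) + \<delta> * ((A *v y) \<bullet> (P *v (A *v y)))"
      by (subst (2) x) (simp add: matrix_vector_right_distrib matrix_vector_mult_scaleR inner_add_right)
    moreover have "\<delta> * ((A *v y) \<bullet> (P *v (A *v y))) \<ge> 0" using \<delta>(1) nonneg by simp
    moreover have "2 * ((A *v y) \<bullet> (P *v y)) + 4 * (\<delta> * ((A *v y) \<bullet> (P *v (A *v y)))) \<le> 0"
      using le[of y] by (simp add: \<delta>(2))
    ultimately show ?thesis by linarith
  qed
  obtain a b where ab: "a > 0" "\<And>y. a * norm y ^ 2 \<le> y \<bullet> (P *v y)" "\<And>y. y \<bullet> (P *v y) \<le> b * norm y ^ 2"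
    using pos_homogeneous_bounds[OF pos_homogeneous_quadratic_form[OF P]] by (metis one_le_numeral)
  have "ct_stable B"
    unfolding ct_stable_def
  proof (intro allI impI)
    fix e :: real assume e: "e > 0"
    define c where "c = max 1 (b / a)"
    have c: "c \<ge> 1" "b \<le> a * c" using ab(1) by (auto simp: c_def field_simps max_def)
    show "\<exists>d>0. \<forall>x. ct_solution B x \<and> norm (x 0) < d \<longrightarrow> (\<forall>t\<ge>0. norm (x t) < e)"
    proof (intro exI[of _ "e / c"] conjI allI impI)
      show "e / c > 0" using e c by simp
      fix x t assume x: "ct_solution B x \<and> norm (x 0) < e / c" and t: "(t::real) \<ge> 0"
      have "x t \<bullet> (P *v x t) \<le> x 0 \<bullet> (P *v x 0)"
      proof (rule nonincreasing_from_derivative[where h' = "\<lambda>t. 2 * ((B *v x t) \<bullet> (P *v x t))", OF _ _ t])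
        fix s :: real assume s: "s \<ge> 0"
        show "((\<lambda>t. x t \<bullet> (P *v x t)) has_real_derivative 2 * ((B *v x s) \<bullet> (P *v x s))) (at s within {0..})"
          using ct_solution_quadratic_form_derivative[OF sym _ s, of B x id_matrix] x by simp
        show "2 * ((B *v x s) \<bullet> (P *v x s)) \<le> 0" using diss[of "x s"] by simp
      qed
      hence "a * norm (x t) ^ 2 \<le> b * norm (x 0) ^ 2" using ab(2)[of "x t"] ab(3)[of "x 0"] by linarith
      also have "\<dots> \<le> (a * c) * norm (x 0) ^ 2" using c(2) by (rule mult_right_mono) simp
      also have "\<dots> \<le> (a * c\<^sup>2) * norm (x 0) ^ 2"
        using ab(1) c(1) by (intro mult_right_mono mult_left_mono) (auto simp: power2_eq_square)
      finally have "norm (x t) ^ 2 \<le> (c * norm (x 0)) ^ 2"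
        using ab(1) by (simp add: power_mult_distrib mult.assoc)
      moreover have "0 \<le> c * norm (x 0)" using c(1) by simp
      ultimately have "norm (x t) \<le> c * norm (x 0)" by (rule power2_le_imp_le)
      also have "\<dots> < e" using x c(1) by (simp add: field_simps)
      finally show "norm (x t) < e" .
    qed
  qed
  with \<delta>(1) inv show ?thesis unfolding B_def N_def by blast
qed

section \<open>Lyapunov inequalities from a convergent Euler discretization\<close>

text \<open>The kernel is the orthogonal complement of the row space.\<close>

lemma rank_nullity:
  fixes A :: "real^'n^'m"
  shows "dim {x. A *v x = 0} + rank A = CARD('n)"
proof -
  have "A *v y = 0 \<longleftrightarrow> (\<forall>x\<in>span (rows A). orthogonal x y)" for y
  proof
    assume y: "A *v y = 0"
    have "orthogonal y (row i A)" for i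
    proof -
      have "row i A \<bullet> y = (A *v y) $ i"
        by (simp add: matrix_vector_mul_component row_def)
      thus ?thesis by (simp add: orthogonal_def inner_commute y)
    qed
    hence "r \<in> rows A \<Longrightarrow> orthogonal y r" for r by (auto simp: rows_def)
    thus "\<forall>x\<in>span (rows A). orthogonal x y"
      using orthogonal_to_span[of _ "rows A" y] by (auto simp: orthogonal_commute)
  next
    assume y: "\<forall>x\<in>span (rows A). orthogonal x y"
    have "(A *v y) $ i = 0" for i
    proof -
      have "orthogonal (row i A) y" using y by (auto intro: span_base simp: rows_def)
      thus ?thesis by (simp add: matrix_vector_mul_component row_def orthogonal_def)
    qed
    thus "A *v y = 0" by (simp add: vec_eq_iff)
  qed
  hence "{x. A *v x = 0} = {y \<in> UNIV. \<forall>x\<in>span (rows A). orthogonal x y}" by auto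
  moreover have "dim {y \<in> UNIV. \<forall>x\<in>span (rows A). orthogonal x y} + dim (span (rows A))
      = dim (UNIV :: (real^'n) set)"
    by (rule dim_subspace_orthogonal_to_vectors) auto
  ultimately show ?thesis by (simp add: row_rank_def)
qed

text \<open>What the Lyapunov constructions need to know about a convergent Euler step \<open>M = I + \<tau> A\<close>:
  \<open>K\<close> is the limit of its powers and \<open>E k\<close> is the \<open>k\<close>-th power times \<open>I - K\<close>.
  The last clause asks for \<open>m \<ge> 1\<close> so that \<open>E 0\<close> is among the \<open>E k\<close> with
  \<open>k < m\<close>.\<close>

definition euler_splitting :: "real \<Rightarrow> real^'n^'n \<Rightarrow> real^'n^'n \<Rightarrow> (nat \<Rightarrow> real^'n^'n) \<Rightarrow> bool" where
  "euler_splitting \<tau> A K E \<longleftrightarrow>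
     (\<forall>x. K *v (A *v x) = 0) \<and> (\<forall>x. x = K *v x + E 0 *v x) \<and>
     (\<forall>k x. E k *v (x + \<tau> *\<^sub>R (A *v x)) = E (Suc k) *v x) \<and>
     (\<forall>x. E 0 *v x = 0 \<longleftrightarrow> A *v x = 0) \<and>
     (\<forall>\<delta>>0. \<exists>m\<ge>1. \<forall>x. norm (E m *v x) \<le> \<delta> * norm (E 0 *v x))"

text \<open>A limit of \<open>E k x\<close> is fixed by \<open>M\<close>, hence lies in the kernel of \<open>A\<close>; it is also
  killed by \<open>K\<close>, hence is zero. Pointwise convergence is uniform in finite dimension, and
  \<open>E m = E m (E 0)\<close> lets the bound be stated relative to \<open>E 0 x\<close>.\<close>

lemma euler_splitting_exists:
  fixes A :: "real^'n^'n"
  assumes \<tau>: "\<tau> > 0" and conv: "dt_convergent (id_matrix + \<tau> *\<^sub>R A)"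
  shows "\<exists>K E. euler_splitting \<tau> A K E"
proof -
  define M where "M = id_matrix + \<tau> *\<^sub>R A"
  have Mv: "M *v x = x + \<tau> *\<^sub>R (A *v x)" for x by (simp add: M_def euler_mult)
  obtain K L where KL: "\<And>x. A *v (K *v x) = 0" "\<And>x. K *v (A *v x) = 0"
    "\<And>x. x = K *v x + L *v (A *v x)"
    using group_inverse[of A] euler_convergent_imp_spectrum[OF assms]
    unfolding convergent_spectrum_def by metis
  have KK: "K *v (K *v x) = K *v x" for x
    using KL(3)[of "K *v x"] by (simp add: KL(1))
  have KM: "K *v (M *v x) = K *v x" for x
    by (simp only: Mv matrix_vector_right_distrib matrix_vector_mult_scaleR KL(2) scaleR_zero_right add_0_right)
  have MK: "M *v (K *v x) = K *v x" for x
    by (simp only: Mv KL(1) scaleR_zero_right add_0_right)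
  define E where "E k = matrix ((*v) M ^^ k) ** (id_matrix - K)" for k
  have E: "E k *v x = ((*v) M ^^ k) (x - K *v x)" for k x
    by (simp add: E_def matrix_works funpow_matrix_linear
        matrix_vector_mult_diff_rdistrib flip: matrix_vector_mul_assoc)
  have E0: "E 0 *v x = x - K *v x" for x by (simp add: E)
  have lim: "(\<lambda>k. E k *v x) \<longlonglongrightarrow> 0" for x
  proof -
    let ?s = "\<lambda>k. ((*v) M ^^ k) (x - K *v x)"
    obtain l where l: "?s \<longlonglongrightarrow> l"
      using conv unfolding dt_convergent_iff M_def[symmetric] convergent_def by blast
    have "(\<lambda>k. M *v ?s k) \<longlonglongrightarrow> l" using LIMSEQ_Suc[OF l] by simp
    moreover have "(\<lambda>k. M *v ?s k) \<longlonglongrightarrow> M *v l"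
      by (rule bounded_linear.tendsto[OF matrix_vector_mul_bounded_linear l])
    ultimately have "l = M *v l" by (rule LIMSEQ_unique)
    hence Al: "A *v l = 0" using \<tau> by (simp add: Mv)
    have "K *v ?s k = 0" for k
      by (induction k) (simp_all add: KM matrix_vector_mult_diff_distrib KK)
    moreover have "(\<lambda>k. K *v ?s k) \<longlonglongrightarrow> K *v l"
      by (rule bounded_linear.tendsto[OF matrix_vector_mul_bounded_linear l])
    ultimately have "(\<lambda>k. 0) \<longlonglongrightarrow> K *v l" by simp
    hence "K *v l = 0" by (rule LIMSEQ_unique[OF tendsto_const, symmetric])
    hence "l = 0" using KL(3)[of l] Al by simp
    thus ?thesis using l by (simp add: E)
  qed
  have "euler_splitting \<tau> A K E"
    unfolding euler_splitting_def
  proof (intro conjI allI impI)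
    show "K *v (A *v x) = 0" for x by (rule KL(2))
    show "x = K *v x + E 0 *v x" for x by (simp add: E0)
    show "E k *v (x + \<tau> *\<^sub>R (A *v x)) = E (Suc k) *v x" for k x
    proof -
      have "E k *v (M *v x) = ((*v) M ^^ k) (M *v (x - K *v x))"
        by (simp only: E KM matrix_vector_mult_diff_distrib MK)
      thus ?thesis by (simp only: Mv[symmetric] E funpow_Suc_right comp_apply)
    qed
    show "E 0 *v x = 0 \<longleftrightarrow> A *v x = 0" for x
    proof
      assume "E 0 *v x = 0"
      hence "x = K *v x" by (simp add: E0)
      thus "A *v x = 0" using KL(1)[of x] by simp
    next
      assume "A *v x = 0"
      thus "E 0 *v x = 0" using KL(3)[of x] by (simp add: E0)
    qed
    fix \<delta> :: real assume \<delta>: "\<delta> > 0"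
    have EE: "E k *v (E 0 *v x) = E k *v x" for k x
      by (simp add: E0 E matrix_vector_mult_diff_distrib KK linear_0[OF funpow_matrix_linear])
    have "(\<lambda>k. \<Sum>i\<in>UNIV. norm (E k *v axis i 1)) \<longlonglongrightarrow> (\<Sum>i\<in>(UNIV::'n set). 0)"
      by (intro tendsto_sum tendsto_norm_zero lim)
    hence "eventually (\<lambda>k. (\<Sum>i\<in>UNIV. norm (E k *v axis i 1)) < \<delta>) sequentially"
      using \<delta> by (intro order_tendstoD) auto
    hence "eventually (\<lambda>k. k \<ge> 1 \<and> (\<Sum>i\<in>UNIV. norm (E k *v axis i 1)) < \<delta>) sequentially"
      using eventually_ge_at_top eventually_conj by blast
    then obtain m where m: "m \<ge> 1" "(\<Sum>i\<in>UNIV. norm (E m *v axis i 1)) < \<delta>"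
      using eventually_happens'[OF trivial_limit_sequentially] by blast
    have "norm (E m *v x) \<le> \<delta> * norm (E 0 *v x)" for x
    proof -
      have "norm (E m *v x) \<le> (\<Sum>i\<in>UNIV. norm (E m *v axis i 1)) * norm (E 0 *v x)"
        using linear_norm_le_axis_sum[OF matrix_vector_mul_linear, of "E m" "E 0 *v x"] by (simp only: EE)
      also have "\<dots> \<le> \<delta> * norm (E 0 *v x)"
        using m(2) by (intro mult_right_mono) auto
      finally show ?thesis .
    qed
    with m(1) show "\<exists>m\<ge>1. \<forall>x. norm (E m *v x) \<le> \<delta> * norm (E 0 *v x)" by blast
  qed
  thus ?thesis by blast
qed

definition gram :: "(nat \<Rightarrow> real^'n^'n) \<Rightarrow> nat \<Rightarrow> real^'n^'n" where
  "gram E m = (\<Sum>k<m. transpose (E k) ** E k)"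

lemma gram_Suc: "gram E (Suc m) = gram E m + transpose (E m) ** E m"
  by (simp add: gram_def)

lemma transpose_gram: "transpose (gram E m) = gram E m"
proof (induction m)
  case 0
  show ?case by (simp add: gram_def vec_eq_iff transpose_def)
qed (simp add: gram_Suc transpose_add matrix_transpose_mul)

lemma inner_transpose_self: "x \<bullet> ((transpose B ** B) *v x) = (norm (B *v x))\<^sup>2" for B :: "real^'n^'n"
  by (simp only: matrix_vector_mul_assoc[symmetric] inner_transpose_matrix dot_square_norm)

lemma inner_gram: "x \<bullet> (gram E m *v x) = (\<Sum>k<m. (norm (E k *v x))\<^sup>2)"
proof (induction m)
  case 0
  show ?case by (simp add: gram_def)
next
  case (Suc m)
  thus ?case
    by (simp add: gram_Suc matrix_vector_mult_add_rdistrib inner_add_right inner_transpose_self)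
qed

lemma quadratic_form_gram_add:
  fixes K P :: "real^'n^'n"
  shows "x \<bullet> ((transpose K ** K + P) *v x) = (norm (K *v x))\<^sup>2 + x \<bullet> (P *v x)"
  by (simp only: matrix_vector_mult_add_rdistrib inner_add_right inner_transpose_self)

lemma transpose_gram_add:
  fixes K P :: "real^'n^'n"
  shows "transpose P = P \<Longrightarrow> transpose (transpose K ** K + P) = transpose K ** K + P"
  by (simp only: transpose_add matrix_transpose_mul transpose_transpose)

text \<open>The term \<open>K\<^sup>T K\<close> is invisible on the range of \<open>A\<close>. Adding it to a semidefinite form
  that degenerates on the kernel of \<open>A\<close> makes the form definite without changing its Lyapunov inequality.\<close>

lemma inner_gram_add_annihilated:
  fixes K P :: "real^'n^'n"
  assumes "K *v y = 0"
  shows "y \<bullet> ((transpose K ** K + P) *v x) = y \<bullet> (P *v x)"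
  by (simp only: matrix_vector_mult_add_rdistrib inner_add_right matrix_vector_mul_assoc[symmetric]
      inner_transpose_matrix assms inner_zero_left add_0_left)

text \<open>One Euler step shifts the sum of \<open>|E k x|\<^sup>2\<close> over \<open>k < m\<close> by one index, so
  it changes it by \<open>|E m x|\<^sup>2 - |E 0 x|\<^sup>2 \<le> 0\<close>. The sum itself vanishes exactly on the kernel of
  \<open>A\<close>, as the rank condition in (g) demands.\<close>

theorem euler_convergent_imp_lyapunov_inequalities:
  fixes A :: "real^'n^'n"
  assumes \<tau>: "\<tau> > 0" and conv: "dt_convergent (id_matrix + \<tau> *\<^sub>R A)"
  shows "\<exists>P. dissipative \<tau> P A"
    and "\<exists>Q P. pos_def Q \<and> pos_semidef P \<and> rank P = CARD('n) - dim {x. A *v x = 0} \<and>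
               pos_semidef (- (transpose A ** P + P ** A + transpose A ** Q ** A))"
proof -
  obtain K E where KE: "euler_splitting \<tau> A K E"
    using euler_splitting_exists[OF assms] by blast
  have KA: "K *v (A *v x) = 0" and split: "x = K *v x + E 0 *v x"
    and EM: "E k *v (x + \<tau> *\<^sub>R (A *v x)) = E (Suc k) *v x"
    and E0: "E 0 *v x = 0 \<longleftrightarrow> A *v x = 0"
    and small: "\<delta> > 0 \<Longrightarrow> \<exists>m\<ge>1. \<forall>x. norm (E m *v x) \<le> \<delta> * norm (E 0 *v x)" for x k \<delta>
    using KE unfolding euler_splitting_def by blast+
  obtain m where m: "m \<ge> 1" "\<And>x. norm (E m *v x) \<le> norm (E 0 *v x)"
    using small[of 1] by auto
  define G where "G = gram E m"
  define P where "P = transpose K ** K + G"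
  have symG: "transpose G = G" unfolding G_def by (rule transpose_gram)
  have symP: "transpose P = P" unfolding P_def by (rule transpose_gram_add[OF symG])
  have qG: "x \<bullet> (G *v x) = (\<Sum>k<m. (norm (E k *v x))\<^sup>2)" for x
    unfolding G_def by (rule inner_gram)
  have qP: "x \<bullet> (P *v x) = (norm (K *v x))\<^sup>2 + x \<bullet> (G *v x)" for x
    unfolding P_def by (rule quadratic_form_gram_add)
  have qG_nonneg: "x \<bullet> (G *v x) \<ge> 0" for x by (simp add: qG sum_nonneg)
  have E0_zero: "E 0 *v x = 0" if "x \<bullet> (G *v x) = 0" for x
  proof -
    have "(norm (E 0 *v x))\<^sup>2 = 0"
      using that m(1) by (simp add: qG sum_nonneg_eq_0_iff)
    thus ?thesis by simp
  qed
  have decr: "(x + \<tau> *\<^sub>R (A *v x)) \<bullet> (G *v (x + \<tau> *\<^sub>R (A *v x))) \<le> x \<bullet> (G *v x)" for x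
  proof -
    have "(\<Sum>k<m. (norm (E (Suc k) *v x))\<^sup>2) + (norm (E 0 *v x))\<^sup>2
        = (\<Sum>k<Suc m. (norm (E k *v x))\<^sup>2)"
      by (subst sum.lessThan_Suc_shift) simp
    moreover have "(norm (E m *v x))\<^sup>2 \<le> (norm (E 0 *v x))\<^sup>2"
      using m(2) by (intro power_mono) auto
    moreover have "(\<Sum>k<Suc m. (norm (E k *v x))\<^sup>2) = (\<Sum>k<m. (norm (E k *v x))\<^sup>2) + (norm (E m *v x))\<^sup>2"
      by simp
    ultimately show ?thesis unfolding qG EM by linarith
  qed
  have ineqG: "2 * ((A *v x) \<bullet> (G *v x)) + \<tau> * ((A *v x) \<bullet> (G *v (A *v x))) \<le> 0" for x
    using decr[of x] \<tau> unfolding euler_quadratic_form[OF symG] by (simp add: mult_le_0_iff)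
  have AP: "(A *v x) \<bullet> (P *v y) = (A *v x) \<bullet> (G *v y)" for x y
    unfolding P_def by (rule inner_gram_add_annihilated[OF KA])
  have pdP: "pos_def P"
    unfolding pos_def_def
  proof (intro conjI allI impI symP)
    fix x :: "real^'n" assume "x \<noteq> 0"
    show "x \<bullet> (P *v x) > 0"
    proof (rule ccontr)
      assume "\<not> ?thesis"
      with qP[of x] qG_nonneg[of x] have "(norm (K *v x))\<^sup>2 = 0" "x \<bullet> (G *v x) = 0"
        by (smt (verit) zero_le_power2)+
      hence "K *v x = 0" "E 0 *v x = 0" using E0_zero by auto
      thus False using split[of x] \<open>x \<noteq> 0\<close> by simp
    qed
  qed
  show "\<exists>P. dissipative \<tau> P A"
    unfolding dissipative_def
    by (rule exI[of _ P]) (simp add: \<tau> pdP AP ineqG)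
  show "\<exists>Q P. pos_def Q \<and> pos_semidef P \<and> rank P = CARD('n) - dim {x. A *v x = 0} \<and>
               pos_semidef (- (transpose A ** P + P ** A + transpose A ** Q ** A))"
  proof (intro exI conjI)
    show "pos_def (\<tau> *\<^sub>R P)"
      using pdP \<tau> by (auto simp: pos_def_def transpose_scalar scaleR_matrix_vector_assoc[symmetric])
    show "pos_semidef G" using symG qG_nonneg by (simp add: pos_semidef_def)
    have "G *v x = 0 \<longleftrightarrow> A *v x = 0" for x
    proof
      assume "G *v x = 0"
      thus "A *v x = 0" using E0_zero[of x] E0 by simp
    next
      assume Ax: "A *v x = 0"
      have "E k *v x = 0" for k
      proof (induction k)
        case (Suc k)
        thus ?case using EM[of k x] Ax by simp
      qed (use Ax E0 in simp)
      thus "G *v x = 0"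
        by (simp add: G_def gram_def) (induction m, simp_all add: matrix_vector_mult_add_rdistrib flip: matrix_vector_mul_assoc)
    qed
    thus "rank G = CARD('n) - dim {x. A *v x = 0}" using rank_nullity[of G] by simp
    have "2 * ((A *v x) \<bullet> (G *v x)) + (A *v x) \<bullet> ((\<tau> *\<^sub>R P) *v (A *v x)) \<le> 0" for x
      using ineqG[of x] AP[of x "A *v x"] by (simp flip: scaleR_matrix_vector_assoc)
    thus "pos_semidef (- (transpose A ** G + G ** A + transpose A ** (\<tau> *\<^sub>R P) ** A))"
      by (subst lyapunov_inequality_iff) (simp_all add: symG symP transpose_scalar)
  qed
qed

text \<open>Otherwise the form would become negative when moving from \<open>x\<close> a little way against
  \<open>P x\<close>.\<close>

lemma pos_semidef_form_eq_0:
  assumes P: "pos_semidef P" and x: "x \<bullet> (P *v x) = 0"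
  shows "P *v x = 0"
proof (rule ccontr)
  assume "P *v x \<noteq> 0"
  define n where "n = (P *v x) \<bullet> (P *v x)"
  define c where "c = (P *v x) \<bullet> (P *v (P *v x))"
  \<comment> \<open>The denominator is shifted by one because \<open>c\<close> may vanish.\<close>
  define s where "s = n / (c + 1)"
  have n: "n > 0" using \<open>P *v x \<noteq> 0\<close> by (simp add: n_def)
  have c: "c \<ge> 0" using P by (simp add: c_def pos_semidef_def)
  have s: "s > 0" "s * c \<le> n" using n c by (auto simp: s_def field_simps)
  have "0 \<le> (x + (- s) *\<^sub>R (P *v x)) \<bullet> (P *v (x + (- s) *\<^sub>R (P *v x)))"
    using P unfolding pos_semidef_def by blast
  also have "\<dots> = 0 + 2 * (- s * n) + - s * (- s * c)"
    using P unfolding pos_semidef_def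
    by (subst quadratic_form_add)
      (simp_all only: x matrix_vector_mult_scaleR inner_scaleR_left inner_scaleR_right n_def c_def)
  also have "\<dots> = s * (s * c - 2 * n)" by (simp add: algebra_simps)
  finally have "s * c - 2 * n \<ge> 0" using s(1) by (simp add: zero_le_mult_iff)
  thus False using s(2) n by linarith
qed

text \<open>The inequality shows that the kernel of \<open>P\<close> lies in that of \<open>A\<close>, and the rank
  condition makes the two equal. Then \<open>A\<^sup>2 z = 0\<close> makes the mixed term
  \<open>A z \<bullet> P z\<close> vanish, so \<open>A z = 0\<close> and the projection \<open>K\<close> onto the kernel exists.
  Adding \<open>K\<^sup>T K\<close> to \<open>P\<close> makes it definite.\<close>

theorem semidefinite_lyapunov_imp_dissipative:
  fixes A P Q :: "real^'n^'n"
  assumes Q: "pos_def Q" and P: "pos_semidef P" and rk: "rank P = CARD('n) - dim {x. A *v x = 0}"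
    and ineq: "pos_semidef (- (transpose A ** P + P ** A + transpose A ** Q ** A))"
  shows "\<exists>\<epsilon> R. dissipative \<epsilon> R A"
proof -
  have symP: "transpose P = P" and symQ: "transpose Q = Q"
    using P Q by (auto simp: pos_semidef_def pos_def_def)
  have le: "2 * ((A *v x) \<bullet> (P *v x)) + (A *v x) \<bullet> (Q *v (A *v x)) \<le> 0" for x
    using ineq lyapunov_inequality_iff[OF symP symQ] by blast
  have Qz: "x = 0" if "x \<bullet> (Q *v x) \<le> 0" for x
    using Q that unfolding pos_def_def by (meson not_le)
  have sub: "{x. P *v x = 0} \<subseteq> {x. A *v x = 0}"
  proof safe
    fix x assume "P *v x = 0"
    thus "A *v x = 0" using le[of x] Qz[of "A *v x"] by simp
  qed
  have "dim {x. A *v x = 0} \<le> dim {x. P *v x = 0}" using rank_nullity[of P] rank_nullity[of A] rk by linarith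
  hence eq: "{x. P *v x = 0} = {x. A *v x = 0}"
    by (intro subspace_dim_equal sub) (auto intro!: linear_subspace_kernel)
  have ker: "A *v z = 0" if "A *v (A *v z) = 0" for z
  proof -
    have "P *v (A *v z) = 0" using that eq by blast
    hence "(A *v z) \<bullet> (P *v z) = 0" using inner_symmetric_matrix[OF symP, of "A *v z" z] by simp
    thus ?thesis using le[of z] Qz[of "A *v z"] by simp
  qed
  obtain K L where KL: "\<And>x. A *v (K *v x) = 0" "\<And>x. K *v (A *v x) = 0"
    "\<And>x. x = K *v x + L *v (A *v x)"
    using group_inverse[OF ker] by metis
  obtain a where a: "a > 0" "\<And>y. a * norm y ^ 2 \<le> y \<bullet> (Q *v y)"
    using pos_homogeneous_bounds[OF pos_homogeneous_quadratic_form[OF Q]] by (metis one_le_numeral)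
  define R where "R = transpose K ** K + P"
  have symR: "transpose R = R" unfolding R_def by (rule transpose_gram_add[OF symP])
  have qR: "x \<bullet> (R *v x) = (norm (K *v x))\<^sup>2 + x \<bullet> (P *v x)" for x
    unfolding R_def by (rule quadratic_form_gram_add)
  have AR: "(A *v x) \<bullet> (R *v y) = (A *v x) \<bullet> (P *v y)" for x y
    unfolding R_def by (rule inner_gram_add_annihilated[OF KL(2)])
  have P_nonneg: "x \<bullet> (P *v x) \<ge> 0" for x using P by (simp add: pos_semidef_def)
  have pdR: "pos_def R"
    unfolding pos_def_def
  proof (intro conjI allI impI symR)
    fix x :: "real^'n" assume "x \<noteq> 0"
    show "x \<bullet> (R *v x) > 0"
    proof (rule ccontr)
      assume "\<not> ?thesis"
      with qR[of x] P_nonneg[of x] have "(norm (K *v x))\<^sup>2 = 0" "x \<bullet> (P *v x) = 0"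
        by (smt (verit) zero_le_power2)+
      hence "K *v x = 0" "A *v x = 0" using pos_semidef_form_eq_0[OF P] eq by auto
      thus False using KL(3)[of x] \<open>x \<noteq> 0\<close> by simp
    qed
  qed
  obtain b where b: "\<And>y. y \<bullet> (R *v y) \<le> b * norm y ^ 2"
    using pos_homogeneous_bounds[OF pos_homogeneous_quadratic_form[OF pdR]] by (metis one_le_numeral)
  \<comment> \<open>Small enough for \<open>\<epsilon> R\<close> to be dominated by \<open>Q\<close>.\<close>
  define \<epsilon> where "\<epsilon> = a / (\<bar>b\<bar> + 1)"
  have \<epsilon>: "\<epsilon> > 0" using a(1) by (simp add: \<epsilon>_def)
  have \<epsilon>b: "\<epsilon> * b \<le> a"
  proof -
    have "\<epsilon> * b \<le> \<epsilon> * (\<bar>b\<bar> + 1)" using \<epsilon> by (intro mult_left_mono) auto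
    also have "\<dots> = a" by (simp add: \<epsilon>_def)
    finally show ?thesis .
  qed
  have "\<epsilon> * (y \<bullet> (R *v y)) \<le> y \<bullet> (Q *v y)" for y
  proof -
    have "\<epsilon> * (y \<bullet> (R *v y)) \<le> \<epsilon> * (b * norm y ^ 2)" using b \<epsilon> by (intro mult_left_mono) auto
    also have "\<dots> = (\<epsilon> * b) * norm y ^ 2" by simp
    also have "\<dots> \<le> a * norm y ^ 2" using \<epsilon>b by (intro mult_right_mono) auto
    also have "\<dots> \<le> y \<bullet> (Q *v y)" by (rule a(2))
    finally show ?thesis .
  qed
  hence "2 * ((A *v x) \<bullet> (R *v x)) + \<epsilon> * ((A *v x) \<bullet> (R *v (A *v x))) \<le> 0" for x
    using le[of x] unfolding AR[of x x] by (meson add_left_mono order.trans)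
  with \<epsilon> pdR show ?thesis unfolding dissipative_def by blast
qed

section \<open>Polyhedral Lyapunov functions\<close>

text \<open>As for quadratic forms, an Euler step shifts the index of \<open>E k\<close>. Comparing
  \<open>E m x\<close> with \<open>E 0 x\<close> in the maximum norm costs a factor \<open>n\<close>, which is why
  \<open>m\<close> is chosen for the contraction constant \<open>1 / n\<close>. Steps shorter than \<open>\<tau>\<close> follow by
  convexity.\<close>

theorem euler_convergent_imp_polyhedral_lyapunov:
  fixes A :: "real^'n^'n"
  assumes \<tau>: "\<tau> > 0" and conv: "dt_convergent (id_matrix + \<tau> *\<^sub>R A)"
  shows "\<exists>V. weak_polyhedral_lyapunov A V"
proof -
  obtain K E where KE: "euler_splitting \<tau> A K E"
    using euler_splitting_exists[OF assms] by blast
  have KA: "K *v (A *v x) = 0" and split: "x = K *v x + E 0 *v x"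
    and EM: "E k *v (x + \<tau> *\<^sub>R (A *v x)) = E (Suc k) *v x"
    and small: "\<delta> > 0 \<Longrightarrow> \<exists>m\<ge>1. \<forall>x. norm (E m *v x) \<le> \<delta> * norm (E 0 *v x)" for x k \<delta>
    using KE unfolding euler_splitting_def by blast+
  obtain m where m: "m \<ge> 1" "\<And>x. norm (E m *v x) \<le> 1 / real CARD('n) * norm (E 0 *v x)"
    using small[of "1 / real CARD('n)"] by auto
  define Ls where "Ls = insert K (E ` {..<m})"
  define F where "F = (\<lambda>(s, B, i). s *\<^sub>R row i B) ` ({-1, 1} \<times> Ls \<times> (UNIV :: 'n set))"
  have finF: "finite F" unfolding F_def Ls_def by simp
  have neF: "F \<noteq> {}" unfolding F_def Ls_def by simp
  define V where "V x = Max ((\<lambda>f. f \<bullet> x) ` F)" for x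
  have V_ge: "f \<bullet> x \<le> V x" if "f \<in> F" for f x
    unfolding V_def using that finF by simp
  have V_le: "V x \<le> c" if "\<And>f. f \<in> F \<Longrightarrow> f \<bullet> x \<le> c" for x c
    unfolding V_def using that finF neF by simp
  have row: "row i B \<bullet> x = (B *v x) $ i" for i x and B :: "real^'n^'n"
    by (simp add: matrix_vector_mul_component row_def)
  have entry: "\<bar>(B *v x) $ i\<bar> \<le> V x" if "B \<in> Ls" for B i x
  proof -
    have "s *\<^sub>R row i B \<in> F" if "s = - 1 \<or> s = 1" for s
      using that \<open>B \<in> Ls\<close> unfolding F_def by force
    hence "(- 1 *\<^sub>R row i B) \<bullet> x \<le> V x" "(1 *\<^sub>R row i B) \<bullet> x \<le> V x" using V_ge by blast+
    thus ?thesis by (simp add: row)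
  qed
  have V_leI: "V y \<le> V x" if "\<And>B i. B \<in> Ls \<Longrightarrow> \<bar>(B *v y) $ i\<bar> \<le> V x" for x y
  proof (rule V_le)
    fix f assume "f \<in> F"
    then obtain s B i where f: "f = s *\<^sub>R row i B" "s = - 1 \<or> s = 1" "B \<in> Ls" by (auto simp: F_def)
    thus "f \<bullet> y \<le> V x" using that[of B i] by (auto simp: row)
  qed
  have mono: "V (x + \<tau> *\<^sub>R (A *v x)) \<le> V x" for x
  proof (rule V_leI)
    fix B i assume "B \<in> Ls"
    then consider "B = K" | k where "k < m" "B = E k" by (auto simp: Ls_def)
    thus "\<bar>(B *v (x + \<tau> *\<^sub>R (A *v x))) $ i\<bar> \<le> V x"
    proof cases
      case 1
      have "K *v (x + \<tau> *\<^sub>R (A *v x)) = K *v x"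
        by (simp only: matrix_vector_right_distrib matrix_vector_mult_scaleR KA scaleR_zero_right add_0_right)
      thus ?thesis using entry[of K x i] 1 by (simp add: Ls_def)
    next
      case k: 2
      show ?thesis
      proof (cases "Suc k < m")
        case True
        hence "E (Suc k) \<in> Ls" by (simp add: Ls_def)
        thus ?thesis using entry k(2) by (simp add: EM)
      next
        case False
        with k have Sk: "Suc k = m" by simp
        have "E 0 \<in> Ls" using m(1) by (auto simp: Ls_def)
        have "\<bar>(E m *v x) $ i\<bar> \<le> norm (E m *v x)" by (rule component_le_norm_cart)
        also have "\<dots> \<le> 1 / real CARD('n) * norm (E 0 *v x)" by (rule m(2))
        also have "\<dots> \<le> 1 / real CARD('n) * (\<Sum>j\<in>UNIV. \<bar>(E 0 *v x) $ j\<bar>)"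
          by (intro mult_left_mono norm_le_l1_cart) simp
        also have "\<dots> \<le> 1 / real CARD('n) * (\<Sum>j\<in>(UNIV :: 'n set). V x)"
          by (intro mult_left_mono sum_mono entry \<open>E 0 \<in> Ls\<close>) simp
        also have "\<dots> = V x" by simp
        finally show ?thesis using k(2) by (simp add: EM Sk)
      qed
    qed
  qed
  have "positive_definite_fun V"
    unfolding positive_definite_fun_def
  proof (intro conjI allI impI)
    have "(\<lambda>f. f \<bullet> (0 :: real^'n)) ` F = {0}" using neF by auto
    thus "V 0 = 0" by (simp add: V_def)
    fix x :: "real^'n" assume "x \<noteq> 0"
    then obtain B where "B \<in> Ls" "B *v x \<noteq> 0"
      using split[of x] m(1) that[of K] that[of "E 0"] by (force simp: Ls_def)
    then obtain i where "(B *v x) $ i \<noteq> 0" by (auto simp: vec_eq_iff)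
    hence "0 < \<bar>(B *v x) $ i\<bar>" by simp
    also have "\<dots> \<le> V x" by (rule entry[OF \<open>B \<in> Ls\<close>])
    finally show "V x > 0" .
  qed
  moreover have "dini_derivative A V x \<le> 0" for x
    unfolding dini_derivative_def
  proof (rule Limsup_bounded)
    have "eventually (\<lambda>h. h \<in> {0<..<\<tau>}) (at_right 0)" using \<tau> by (rule eventually_at_right_real)
    thus "eventually (\<lambda>h. ereal ((V (x + h *\<^sub>R (A *v x)) - V x) / h) \<le> 0) (at_right 0)"
    proof eventually_elim
      case (elim h)
      define l where "l = h / \<tau>"
      have l: "0 \<le> l" "l \<le> 1" "h = l * \<tau>" using elim \<tau> by (auto simp: l_def)
      have "V (x + h *\<^sub>R (A *v x)) \<le> V x"
      proof (rule V_le)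
        fix f assume f: "f \<in> F"
        have "f \<bullet> (x + h *\<^sub>R (A *v x)) = (1 - l) * (f \<bullet> x) + l * (f \<bullet> (x + \<tau> *\<^sub>R (A *v x)))"
          by (simp add: l(3) inner_add_right algebra_simps)
        also have "\<dots> \<le> (1 - l) * V x + l * V x"
          using l V_ge[OF f, of x] order.trans[OF V_ge[OF f] mono[of x]]
          by (intro add_mono mult_left_mono) auto
        finally show "f \<bullet> (x + h *\<^sub>R (A *v x)) \<le> V x" by (simp add: algebra_simps)
      qed
      thus ?case using elim by (simp add: divide_le_0_iff)
    qed
  qed
  moreover have "\<exists>s::nat. s \<ge> 1 \<and> (\<exists>f :: nat \<Rightarrow> real^'n. \<forall>x. V x = Max ((\<lambda>i. f i \<bullet> x) ` {1..s}))"
  proof -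
    obtain f where "bij_betw f {1..card F} F" using ex_bij_betw_nat_finite_1[OF finF] by blast
    hence f: "f ` {1..card F} = F" by (simp add: bij_betw_def)
    have "V x = Max ((\<lambda>i. f i \<bullet> x) ` {1..card F})" for x
      using image_image[of "\<lambda>g. g \<bullet> x" f "{1..card F}"] unfolding f by (simp add: V_def)
    moreover have "card F \<ge> 1" using finF neF by (simp add: Suc_le_eq card_gt_0_iff)
    ultimately show ?thesis by blast
  qed
  ultimately show ?thesis unfolding weak_polyhedral_lyapunov_def weak_lyapunov_def by blast
qed

text \<open>For fixed \<open>x\<close>, the functionals that are active at \<open>x\<close> do not increase in the
  direction \<open>A x\<close> by the Dini condition, and the inactive ones stay below \<open>V x\<close> for a short step.
  The step length depends on \<open>x\<close>. It becomes uniform because the unit ball of \<open>V\<close> is a bounded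
  polyhedron, hence the convex hull of finitely many points.\<close>

theorem polyhedral_lyapunov_imp_spectrum:
  fixes A :: "real^'n^'n"
  assumes "weak_polyhedral_lyapunov A V"
  shows "convergent_spectrum A"
proof -
  from assms have V0: "V 0 = 0" and Vpos: "\<And>x. x \<noteq> 0 \<Longrightarrow> V x > 0"
    and dini: "\<And>x. dini_derivative A V x \<le> 0"
    by (auto simp: weak_polyhedral_lyapunov_def weak_lyapunov_def positive_definite_fun_def)
  obtain s f where s: "s \<ge> (1::nat)" and V: "\<And>x. V x = Max ((\<lambda>i. f i \<bullet> x) ` {1..s})"
    using assms unfolding weak_polyhedral_lyapunov_def by blast
  have ne: "{1..s} \<noteq> {}" using s by simp
  have V_ge: "f i \<bullet> x \<le> V x" if "i \<in> {1..s}" for i x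
    unfolding V using that by simp
  have V_le_iff: "V x \<le> c \<longleftrightarrow> (\<forall>i\<in>{1..s}. f i \<bullet> x \<le> c)" for x c
    unfolding V using ne by simp
  have V_att: "\<exists>i\<in>{1..s}. V x = f i \<bullet> x" for x
  proof -
    have "V x \<in> (\<lambda>i. f i \<bullet> x) ` {1..s}" unfolding V by (rule Max_in) (use ne in auto)
    thus ?thesis by blast
  qed
  have scale: "V (r *\<^sub>R x) = r * V x" if r: "r > 0" for r x
  proof (rule antisym)
    show "V (r *\<^sub>R x) \<le> r * V x"
      unfolding V_le_iff using V_ge r by simp
    obtain i where i: "i \<in> {1..s}" "V x = f i \<bullet> x" using V_att by blast
    thus "r * V x \<le> V (r *\<^sub>R x)" using V_ge[OF i(1), of "r *\<^sub>R x"] by simp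
  qed
  have cont: "continuous_on UNIV V"
  proof -
    define B where "B = (\<Sum>i\<in>{1..s}. norm (f i))"
    have fB: "norm (f i) \<le> B" if "i \<in> {1..s}" for i
      unfolding B_def by (rule member_le_sum) (use that in auto)
    have "V x - V y \<le> B * norm (x - y)" for x y
    proof -
      obtain i where i: "i \<in> {1..s}" "V x = f i \<bullet> x" using V_att by blast
      have "V x - V y \<le> f i \<bullet> x - f i \<bullet> y" using i V_ge[OF i(1), of y] by simp
      also have "\<dots> = f i \<bullet> (x - y)" by (simp add: inner_diff_right)
      also have "\<dots> \<le> norm (f i) * norm (x - y)" by (rule norm_cauchy_schwarz)
      also have "\<dots> \<le> B * norm (x - y)" using fB[OF i(1)] by (simp add: mult_right_mono)
      finally show ?thesis .
    qed
    from this this have "dist (V x) (V y) \<le> B * dist x y" for x y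
      unfolding dist_norm real_norm_def by (metis abs_le_iff minus_diff_eq norm_minus_commute)
    moreover have "B \<ge> 0" by (simp add: B_def sum_nonneg)
    ultimately have "B-lipschitz_on UNIV V" by (intro lipschitz_onI)
    thus ?thesis by (rule lipschitz_on_continuous_on)
  qed
  have homog: "pos_homogeneous 1 V"
    unfolding pos_homogeneous_def using cont V0 Vpos scale by simp
  have step: "eventually (\<lambda>h. V (x + h *\<^sub>R (A *v x)) \<le> V x) (at_right 0)" for x
  proof -
    have "eventually (\<lambda>h. f i \<bullet> (x + h *\<^sub>R (A *v x)) \<le> V x) (at_right 0)" if i: "i \<in> {1..s}" for i
    proof (cases "f i \<bullet> x = V x")
      case True
      have "ereal (f i \<bullet> (A *v x)) \<le> dini_derivative A V x"
        unfolding dini_derivative_def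
      proof (rule le_Limsup)
        show "eventually (\<lambda>h. ereal (f i \<bullet> (A *v x)) \<le> ereal ((V (x + h *\<^sub>R (A *v x)) - V x) / h)) (at_right 0)"
          using eventually_at_right_less[of 0]
        proof eventually_elim
          case (elim h)
          have "V x + h * (f i \<bullet> (A *v x)) \<le> V (x + h *\<^sub>R (A *v x))"
            using V_ge[OF i, of "x + h *\<^sub>R (A *v x)"] True by (simp add: inner_add_right)
          thus ?case using elim by (simp add: field_simps)
        qed
      qed simp
      with dini[of x] have "ereal (f i \<bullet> (A *v x)) \<le> 0" by (rule order.trans[rotated])
      hence neg: "f i \<bullet> (A *v x) \<le> 0" by simp
      show ?thesis
        using eventually_at_right_less[of 0]
      proof eventually_elim
        case (elim h)
        thus ?case using True neg by (simp add: inner_add_right mult_nonneg_nonpos)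
      qed
    next
      case False
      hence lt: "f i \<bullet> x < V x" using V_ge[OF i, of x] by simp
      have "((\<lambda>h. f i \<bullet> (x + h *\<^sub>R (A *v x))) \<longlongrightarrow> f i \<bullet> (x + 0 *\<^sub>R (A *v x))) (at_right 0)"
        by (intro tendsto_intros)
      hence "eventually (\<lambda>h. f i \<bullet> (x + h *\<^sub>R (A *v x)) < V x) (at_right 0)"
        using lt by (intro order_tendstoD(2)) auto
      thus ?thesis by eventually_elim simp
    qed
    thus ?thesis unfolding V_le_iff by (simp add: eventually_ball_finite_distrib)
  qed
  define C where "C = {x. V x \<le> 1}"
  have C: "C = \<Inter> ((\<lambda>i. {x. f i \<bullet> x \<le> 1}) ` {1..s})"
    unfolding C_def V_le_iff by auto
  have "polyhedron C"
    unfolding C by (rule polyhedron_Inter) (auto intro: polyhedron_halfspace_le)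
  moreover have "bounded C"
  proof -
    obtain a where a: "a > 0" "\<And>x. a * norm x ^ 1 \<le> V x"
      using pos_homogeneous_bounds[OF homog] by (metis order_refl)
    have "norm x \<le> 1 / a" if "x \<in> C" for x
      using a(2)[of x] that a(1) by (simp add: C_def field_simps)
    thus ?thesis by (rule boundedI)
  qed
  ultimately have "polytope C" by (simp add: polytope_eq_bounded_polyhedron)
  then obtain W where W: "finite W" "C = convex hull W" unfolding polytope_def by blast
  have "eventually (\<lambda>h. \<forall>w\<in>W. V (w + h *\<^sub>R (A *v w)) \<le> V w) (at_right 0)"
    using step W(1) by (simp add: eventually_ball_finite_distrib)
  hence "eventually (\<lambda>h::real. 0 < h \<and> (\<forall>w\<in>W. V (w + h *\<^sub>R (A *v w)) \<le> V w)) (at_right 0)"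
    using eventually_at_right_less eventually_conj by blast
  from eventually_happens'[OF _ this] obtain \<tau> :: real
    where \<tau>: "\<tau> > 0" "\<And>w. w \<in> W \<Longrightarrow> V (w + \<tau> *\<^sub>R (A *v w)) \<le> V w" by auto
  \<comment> \<open>Preimage of the unit ball under the Euler step; being convex, it contains the unit ball as soon as it contains its vertices.\<close>
  define D where "D = {x. V (x + \<tau> *\<^sub>R (A *v x)) \<le> 1}"
  have "convex D"
  proof -
    have "D = \<Inter> ((\<lambda>i. {x. f i \<bullet> (x + \<tau> *\<^sub>R (A *v x)) \<le> 1}) ` {1..s})"
      unfolding D_def V_le_iff by auto
    also have "\<dots> = \<Inter> ((\<lambda>i. {x. (f i + \<tau> *\<^sub>R (transpose A *v f i)) \<bullet> x \<le> 1}) ` {1..s})"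
    proof -
      have "f i \<bullet> (x + \<tau> *\<^sub>R (A *v x)) = (f i + \<tau> *\<^sub>R (transpose A *v f i)) \<bullet> x" for i x
        using inner_transpose_matrix[of x A "f i"]
        by (simp add: inner_add_left inner_add_right inner_commute)
      thus ?thesis by simp
    qed
    finally show ?thesis by (auto intro!: convex_INT convex_halfspace_le)
  qed
  moreover have "W \<subseteq> D"
  proof
    fix w assume w: "w \<in> W"
    hence "w \<in> C" using W(2) hull_subset by fast
    thus "w \<in> D" using \<tau>(2)[OF w] by (simp add: C_def D_def)
  qed
  ultimately have CD: "C \<subseteq> D" unfolding W(2) by (rule hull_minimal[rotated])
  have "V (x + \<tau> *\<^sub>R (A *v x)) \<le> V x" for x
  proof (cases "x = 0")
    case False
    define r where "r = inverse (V x)"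
    have r: "r > 0" using Vpos[OF False] by (simp add: r_def)
    have "V (r *\<^sub>R x) = 1" using scale[OF r, of x] Vpos[OF False] by (simp add: r_def)
    hence "r *\<^sub>R x \<in> D" using CD by (auto simp: C_def)
    moreover have "r *\<^sub>R x + \<tau> *\<^sub>R (A *v (r *\<^sub>R x)) = r *\<^sub>R (x + \<tau> *\<^sub>R (A *v x))"
      by (simp add: matrix_vector_mult_scaleR scaleR_add_right mult.commute)
    ultimately have "r * V (x + \<tau> *\<^sub>R (A *v x)) \<le> 1" using scale[OF r] by (simp add: D_def)
    thus ?thesis using Vpos[OF False] by (simp add: r_def field_simps)
  qed (simp add: V0)
  thus ?thesis
    using nonexpansive_euler_imp_spectrum[where g = V and d = 1 and \<tau> = \<tau> and A = A] homog \<tau>(1)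
    by simp
qed

section \<open>Block form\<close>

lemma convergent_spectrum_similar:
  fixes A B T U :: "real^'n^'n"
  assumes UT: "U ** T = id_matrix" and AT: "A ** T = T ** B" and A: "convergent_spectrum A"
  shows "convergent_spectrum B"
  unfolding convergent_spectrum_def
proof (intro conjI allI impI)
  have UTv: "U *v (T *v x) = x" for x by (simp add: matrix_vector_mul_assoc UT)
  have ATv: "A *v (T *v x) = T *v (B *v x)" for x by (simp add: matrix_vector_mul_assoc AT)
  fix z assume "B *v (B *v z) = 0"
  hence "A *v (A *v (T *v z)) = 0" by (simp add: ATv)
  hence "A *v (T *v z) = 0" using A unfolding convergent_spectrum_def by blast
  hence "T *v (B *v z) = 0" by (simp add: ATv)
  thus "B *v z = 0" using UTv[of "B *v z"] by simp
next
  fix \<mu> v assume v: "v \<noteq> 0 \<and> complexify B *v v = \<mu> *s v"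
  have "complexify U *v (complexify T *v v) = v"
    by (simp add: matrix_vector_mul_assoc complexify_id UT flip: complexify_mult)
  hence "complexify T *v v \<noteq> 0" using v by auto
  moreover have "complexify A *v (complexify T *v v) = \<mu> *s (complexify T *v v)"
  proof -
    have "complexify A *v (complexify T *v v) = complexify T *v (complexify B *v v)"
      by (simp add: matrix_vector_mul_assoc AT flip: complexify_mult)
    thus ?thesis using v by (simp add: vector_scalar_commute)
  qed
  ultimately show "\<mu> = 0 \<or> Re \<mu> < 0" using A unfolding convergent_spectrum_def by blast
qed

lemma mult_first_block:
  fixes B :: "real^'n^'n" and e :: "nat \<Rightarrow> 'n"
  assumes e: "bij_betw e {..<CARD('n)} UNIV" and k: "k \<le> CARD('n)"
    and zero: "\<And>j. \<lbrakk>k \<le> j; j < CARD('n)\<rbrakk> \<Longrightarrow> B $ l $ e j = 0"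
  shows "(complexify B *v y) $ l = (\<Sum>j<k. of_real (B $ l $ e j) * y $ e j)"
proof -
  have "(complexify B *v y) $ l = (\<Sum>i\<in>UNIV. of_real (B $ l $ i) * y $ i)"
    by (simp add: matrix_vector_mult_def complexify_def)
  also have "\<dots> = (\<Sum>j<CARD('n). of_real (B $ l $ e j) * y $ e j)"
    using sum.reindex_bij_betw[OF e, of "\<lambda>i. of_real (B $ l $ i) * y $ i"] by simp
  also have "\<dots> = (\<Sum>j<k. of_real (B $ l $ e j) * y $ e j)"
    using k zero by (intro sum.mono_neutral_right) auto
  finally show ?thesis .
qed

text \<open>The first \<open>k\<close> coordinates in the numbering \<open>e\<close>. This is the bridge from vectors over a
  finite index type to vectors of variable dimension.\<close>

definition first_block :: "(nat \<Rightarrow> 'n) \<Rightarrow> nat \<Rightarrow> complex^'n \<Rightarrow> complex Matrix.vec" where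
  "first_block e k y = Matrix.vec k (\<lambda>j. y $ e j)"

lemma first_block_mult:
  fixes B :: "real^'n^'n" and e :: "nat \<Rightarrow> 'n"
  assumes e: "bij_betw e {..<CARD('n)} UNIV" and k: "k \<le> CARD('n)"
    and zero: "\<And>i j. \<lbrakk>k \<le> j; j < CARD('n)\<rbrakk> \<Longrightarrow> B $ e i $ e j = 0"
    and C: "C \<in> carrier_mat k k" "\<And>i j. \<lbrakk>i < k; j < k\<rbrakk> \<Longrightarrow> C $$ (i, j) = B $ e i $ e j"
  shows "map_mat complex_of_real C *\<^sub>v first_block e k y = first_block e k (complexify B *v y)"
proof (rule eq_vecI)
  show "dim_vec (map_mat complex_of_real C *\<^sub>v first_block e k y)
      = dim_vec (first_block e k (complexify B *v y))"
    using C(1) by (simp add: first_block_def)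
next
  fix i assume "i < dim_vec (first_block e k (complexify B *v y))"
  hence i: "i < k" by (simp add: first_block_def)
  have "vec_index (map_mat complex_of_real C *\<^sub>v first_block e k y) i
      = (\<Sum>j<k. of_real (B $ e i $ e j) * y $ e j)"
    using C i by (simp add: first_block_def scalar_prod_def lessThan_atLeast0)
  also have "\<dots> = (complexify B *v y) $ e i"
    by (rule mult_first_block[OF e k zero, symmetric])
  finally show "vec_index (map_mat complex_of_real C *\<^sub>v first_block e k y) i
      = vec_index (first_block e k (complexify B *v y)) i"
    using i by (simp add: first_block_def)
qed

text \<open>As the last block column vanishes, the image of a vector depends only on its first block, and the
  first block evolves under the Hurwitz matrix.\<close>

lemma hurwitz_block_imp_spectrum:
  fixes B :: "real^'n^'n" and e :: "nat \<Rightarrow> 'n"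
  assumes e: "bij_betw e {..<CARD('n)} UNIV" and k: "k \<le> CARD('n)"
    and zero: "\<And>i j. \<lbrakk>k \<le> j; j < CARD('n)\<rbrakk> \<Longrightarrow> B $ e i $ e j = 0"
    and C: "C \<in> carrier_mat k k" "\<And>i j. \<lbrakk>i < k; j < k\<rbrakk> \<Longrightarrow> C $$ (i, j) = B $ e i $ e j"
    and hur: "hurwitz C"
  shows "convergent_spectrum B"
proof -
  let ?C = "map_mat complex_of_real C"
  have l: "\<exists>i. l = e i" for l using e unfolding bij_betw_def by (metis UNIV_I imageE)
  have zero': "B $ l $ e j = 0" if "k \<le> j" "j < CARD('n)" for l j
    using l[of l] zero that by auto
  have vanish: "complexify B *v y = 0" if "first_block e k y = 0\<^sub>v k" for y
  proof -
    have "y $ e j = 0" if "j < k" for j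
      using arg_cong[OF \<open>first_block e k y = 0\<^sub>v k\<close>, of "\<lambda>v. vec_index v j"] that
      by (simp add: first_block_def)
    thus ?thesis by (simp add: vec_eq_iff mult_first_block[OF e k zero'])
  qed
  have ev: "Re \<mu> < 0" if "first_block e k y \<noteq> 0\<^sub>v k" "?C *\<^sub>v first_block e k y = \<mu> \<cdot>\<^sub>v first_block e k y" for y \<mu>
  proof -
    have "eigenvector ?C (first_block e k y) \<mu>"
      using that C(1) by (simp add: eigenvector_def first_block_def)
    thus ?thesis using hur unfolding hurwitz_def eigenvalue_def by blast
  qed
  note mult = first_block_mult[OF e k zero C]
  \<comment> \<open>A Hurwitz matrix is injective, since \<open>0\<close> does not lie in the open left half-plane.\<close>
  have inj: "first_block e k y = 0\<^sub>v k" if "first_block e k (complexify B *v y) = 0\<^sub>v k" for y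
  proof (rule ccontr)
    assume "first_block e k y \<noteq> 0\<^sub>v k"
    moreover have "?C *\<^sub>v first_block e k y = 0 \<cdot>\<^sub>v first_block e k y"
    proof -
      have "?C *\<^sub>v first_block e k y = 0\<^sub>v k" using mult[of y] that by simp
      thus ?thesis by (auto simp: first_block_def)
    qed
    ultimately have "Re 0 < 0" by (rule ev)
    thus False by simp
  qed
  show ?thesis
    unfolding convergent_spectrum_def
  proof (intro conjI allI impI)
    fix z assume z: "B *v (B *v z) = 0"
    let ?z = "(\<chi> i. complex_of_real (z $ i)) :: complex^'n"
    have "complexify B *v (complexify B *v ?z) = 0"
      unfolding complexify_of_real_vec z by (simp add: vec_eq_iff)
    hence "first_block e k (complexify B *v (complexify B *v ?z)) = 0\<^sub>v k"
      by (auto simp: first_block_def)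
    hence "complexify B *v ?z = 0" using inj vanish by blast
    thus "B *v z = 0" unfolding complexify_of_real_vec by (simp add: vec_eq_iff)
  next
    fix \<mu> v assume v: "v \<noteq> 0 \<and> complexify B *v v = \<mu> *s v"
    show "\<mu> = 0 \<or> Re \<mu> < 0"
    proof (cases "\<mu> = 0")
      case False
      have "first_block e k v \<noteq> 0\<^sub>v k"
      proof
        assume "first_block e k v = 0\<^sub>v k"
        from trans[OF conjunct2[OF v, symmetric] vanish[OF this]] have "\<mu> *s v = 0" .
        thus False using v False by (simp add: vector_mul_eq_0)
      qed
      moreover have "?C *\<^sub>v first_block e k v = \<mu> \<cdot>\<^sub>v first_block e k v"
      proof -
        have "?C *\<^sub>v first_block e k v = first_block e k (\<mu> *s v)" using mult[of v] v by simp
        thus ?thesis by (auto simp: first_block_def)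
      qed
      ultimately show ?thesis using ev by blast
    qed simp
  qed
qed

lemma array_of_four_block_iff:
  fixes B :: "real^'n^'n"
  assumes k: "k \<le> CARD('n)" and C: "C \<in> carrier_mat k k" and D: "D \<in> carrier_mat (CARD('n) - k) k"
  shows "array_of e B = four_block_mat C (0\<^sub>m k (CARD('n) - k)) D (0\<^sub>m (CARD('n) - k) (CARD('n) - k))
    \<longleftrightarrow> (\<forall>i<CARD('n). \<forall>j<CARD('n). B $ e i $ e j =
         (if k \<le> j then 0 else if i < k then C $$ (i, j) else D $$ (i - k, j)))"
    (is "_ = ?R \<longleftrightarrow> _")
proof -
  have dims: "dim_row ?R = CARD('n)" "dim_col ?R = CARD('n)" using k C D by auto
  have ent: "?R $$ (i, j) = (if k \<le> j then 0 else if i < k then C $$ (i, j) else D $$ (i - k, j))"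
    if "i < CARD('n)" "j < CARD('n)" for i j
    using that k C D by (auto simp: index_mat_four_block)
  show ?thesis
  proof
    assume eq: "array_of e B = ?R"
    show "\<forall>i<CARD('n). \<forall>j<CARD('n). B $ e i $ e j =
         (if k \<le> j then 0 else if i < k then C $$ (i, j) else D $$ (i - k, j))"
    proof (intro allI impI)
      fix i j assume ij: "i < CARD('n)" "j < CARD('n)"
      have "B $ e i $ e j = array_of e B $$ (i, j)" using ij by (simp add: array_of_def)
      thus "B $ e i $ e j = (if k \<le> j then 0 else if i < k then C $$ (i, j) else D $$ (i - k, j))"
        unfolding eq ent[OF ij] .
    qed
  next
    assume *: "\<forall>i<CARD('n). \<forall>j<CARD('n). B $ e i $ e j =
         (if k \<le> j then 0 else if i < k then C $$ (i, j) else D $$ (i - k, j))"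
    show "array_of e B = ?R"
    proof (rule eq_matI)
      fix i j assume "i < dim_row ?R" "j < dim_col ?R"
      hence ij: "i < CARD('n)" "j < CARD('n)" unfolding dims .
      thus "array_of e B $$ (i, j) = ?R $$ (i, j)"
        unfolding ent[OF ij] using * by (simp add: array_of_def)
    qed (simp_all only: dims, simp_all add: array_of_def)
  qed
qed

definition hurwitz_block_form :: "(nat \<Rightarrow> 'n) \<Rightarrow> real^'n^'n \<Rightarrow> bool" where
  "hurwitz_block_form e A \<longleftrightarrow> (\<exists>T :: real^'n^'n. invertible T \<and>
     (\<exists>k\<le>CARD('n). \<exists>A_as \<in> carrier_mat k k. \<exists>A_r \<in> carrier_mat (CARD('n) - k) k.
        hurwitz A_as \<and>
        array_of e (matrix_inv T ** A ** T) =
          four_block_mat A_as (0\<^sub>m k (CARD('n) - k))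
                         A_r  (0\<^sub>m (CARD('n) - k) (CARD('n) - k))))"

theorem hurwitz_block_form_imp_spectrum:
  fixes A :: "real^'n^'n" and e :: "nat \<Rightarrow> 'n"
  assumes e: "bij_betw e {..<CARD('n)} UNIV" and "hurwitz_block_form e A"
  shows "convergent_spectrum A"
proof -
  obtain T :: "real^'n^'n" and k C D where T: "invertible T" and k: "k \<le> CARD('n)"
    and C: "C \<in> carrier_mat k k" and D: "D \<in> carrier_mat (CARD('n) - k) k" and hur: "hurwitz C"
    and arr: "array_of e (matrix_inv T ** A ** T) =
          four_block_mat C (0\<^sub>m k (CARD('n) - k)) D (0\<^sub>m (CARD('n) - k) (CARD('n) - k))"
    using assms(2) unfolding hurwitz_block_form_def by blast
  define U where "U = matrix_inv T"
  define B where "B = U ** A ** T"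
  have UT: "U ** T = id_matrix" "T ** U = id_matrix" using matrix_inv_mult[OF T] by (auto simp: U_def)
  have ent: "B $ e i $ e j = (if k \<le> j then 0 else if i < k then C $$ (i, j) else D $$ (i - k, j))"
    if "i < CARD('n)" "j < CARD('n)" for i j
    using arr that unfolding array_of_four_block_iff[OF k C D] B_def U_def by blast
  have "convergent_spectrum B"
  proof (rule hurwitz_block_imp_spectrum[OF e k _ C _ hur])
    fix i j assume j: "k \<le> j" "j < CARD('n)"
    obtain i' where i': "i' < CARD('n)" "e i = e i'"
      using e unfolding bij_betw_def by (metis UNIV_I imageE lessThan_iff)
    show "B $ e i $ e j = 0" using ent[OF i'(1) j(2)] j(1) i'(2) by simp
  next
    fix i j assume "i < k" "j < k"
    thus "C $$ (i, j) = B $ e i $ e j" using ent[of i j] k by simp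
  qed
  moreover have "B ** U = U ** A"
  proof -
    have "B ** U = U ** A ** (T ** U)" by (simp only: B_def matrix_mul_assoc)
    thus ?thesis by (simp add: UT)
  qed
  ultimately show ?thesis using convergent_spectrum_similar[OF UT(2)] by blast
qed

text \<open>The columns of \<open>T\<close> are a basis of the range followed by a basis of the kernel. Both spaces
  are invariant, so the transformed matrix is block diagonal with a zero block on the kernel. An eigenvector
  of the block on the range extends by zero to one of \<open>A\<close> inside the range, where the eigenvalue
  \<open>0\<close> is impossible.\<close>

theorem spectrum_imp_hurwitz_block_form:
  fixes A :: "real^'n^'n" and e :: "nat \<Rightarrow> 'n"
  assumes e: "bij_betw e {..<CARD('n)} UNIV" and A: "convergent_spectrum A"
  shows "hurwitz_block_form e A"
proof -
  have ker: "\<And>z. A *v (A *v z) = 0 \<Longrightarrow> A *v z = 0"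
    using A unfolding convergent_spectrum_def by blast
  let ?R = "range ((*v) A)" and ?N = "{x. A *v x = 0}"
  define k where "k = dim ?R"
  have dims: "dim ?N + k = CARD('n)" using rank_nullity[of A] by (simp add: k_def rank_dim_range)
  have k: "k \<le> CARD('n)" using dims by simp
  have sR: "subspace ?R" by (intro linear_subspace_image) auto
  obtain X where X: "X \<subseteq> ?R" "independent X" "?R \<subseteq> span X" "card X = k"
    using basis_exists[of ?R] unfolding k_def by metis
  obtain Y where Y: "Y \<subseteq> ?N" "independent Y" "?N \<subseteq> span Y" "card Y = CARD('n) - k"
    using basis_exists[of ?N] dims by (metis add_diff_cancel_right')
  obtain f where f: "bij_betw f {0..<k} X"
    using ex_bij_betw_nat_finite[of X] X(2,4) independent_imp_finite by metis
  obtain g where g: "bij_betw g {0..<CARD('n) - k} Y"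
    using ex_bij_betw_nat_finite[of Y] Y(2,4) independent_imp_finite by metis
  define b where "b j = (if j < k then f j else g (j - k))" for j
  have bR: "b j \<in> ?R" if "j < k" for j
    using that f X(1) by (auto simp: b_def bij_betw_def)
  have bN: "A *v b j = 0" if "k \<le> j" "j < CARD('n)" for j
  proof -
    have "g (j - k) \<in> Y" using that g by (auto simp: bij_betw_def)
    thus ?thesis using Y(1) that by (auto simp: b_def)
  qed
  have X_b: "X \<subseteq> b ` {..<k}"
  proof
    fix x assume "x \<in> X"
    then obtain j where "j < k" "x = f j" using f by (auto simp: bij_betw_def)
    thus "x \<in> b ` {..<k}" by (auto simp: b_def)
  qed
  have Y_b: "Y \<subseteq> b ` {k..<CARD('n)}"
  proof
    fix y assume "y \<in> Y"
    then obtain j where "j < CARD('n) - k" "y = g j" using g by (auto simp: bij_betw_def)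
    thus "y \<in> b ` {k..<CARD('n)}" by (intro image_eqI[of _ _ "j + k"]) (auto simp: b_def)
  qed
  define ei where "ei = the_inv_into {..<CARD('n)} e"
  have ei: "ei (e j) = j" if "j < CARD('n)" for j
    unfolding ei_def using e that by (intro the_inv_into_f_f) (auto simp: bij_betw_def)
  have ei_lt: "ei l < CARD('n)" and e_ei: "e (ei l) = l" for l
  proof -
    obtain j where "j < CARD('n)" "l = e j" using e unfolding bij_betw_def by (metis UNIV_I imageE lessThan_iff)
    thus "ei l < CARD('n)" "e (ei l) = l" using ei by auto
  qed
  define T :: "real^'n^'n" where "T = (\<chi> i l. b (ei l) $ i)"
  have T_axis: "T *v axis l 1 = b (ei l)" for l
    by (simp add: matrix_vector_mult_basis column_def T_def)
  have b_range: "b j \<in> range ((*v) T)" if "j < CARD('n)" for j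
    using T_axis[of "e j"] ei[OF that] by (metis rangeI)
  have "range ((*v) T) = UNIV"
  proof -
    have sT: "subspace (range ((*v) T))" by (intro linear_subspace_image) auto
    have "span X \<subseteq> range ((*v) T)" "span Y \<subseteq> range ((*v) T)"
      using X_b Y_b b_range k by (intro span_minimal sT; force)+
    hence sub: "?R \<subseteq> range ((*v) T)" "?N \<subseteq> range ((*v) T)" using X(3) Y(3) by auto
    have "x \<in> range ((*v) T)" for x
    proof -
      obtain z where "A *v x = A *v (A *v z)" using range_square[OF ker] by blast
      hence "x - A *v z \<in> ?N" by (simp add: matrix_vector_mult_diff_distrib)
      moreover have "A *v z \<in> ?R" by simp
      ultimately have "(x - A *v z) + A *v z \<in> range ((*v) T)"
        using sub by (intro subspace_add[OF sT]) blast+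
      thus ?thesis by simp
    qed
    thus ?thesis by blast
  qed
  hence T: "invertible T"
    using matrix_right_invertible_surjective[of T] invertible_right_inverse[of T] by blast
  define U where "U = matrix_inv T"
  have UT: "U ** T = id_matrix" "T ** U = id_matrix" using matrix_inv_mult[OF T] by (auto simp: U_def)
  have U_b: "U *v b j = axis (e j) 1" if "j < CARD('n)" for j
  proof -
    have "U *v (T *v axis (e j) 1) = axis (e j) 1" by (simp add: matrix_vector_mul_assoc UT)
    thus ?thesis by (simp add: T_axis ei[OF that])
  qed
  have U_R: "(U *v x) $ e i = 0" if x: "x \<in> ?R" and i: "k \<le> i" "i < CARD('n)" for x i
  proof -
    have s: "subspace {x. (U *v x) $ e i = 0}"
      by (rule subspaceI) (auto simp: matrix_vector_right_distrib matrix_vector_mult_scaleR)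
    have "X \<subseteq> {x. (U *v x) $ e i = 0}"
    proof
      fix x assume "x \<in> X"
      then obtain j where j: "j < k" "x = b j" using X_b by auto
      have "e i \<noteq> e j" using e i j k unfolding bij_betw_def inj_on_def by (metis lessThan_iff less_le_trans not_le)
      thus "x \<in> {x. (U *v x) $ e i = 0}" using U_b[of j] j k by (simp add: axis_def)
    qed
    from span_minimal[OF this s] x X(3) show ?thesis by blast
  qed
  have T_R: "T *v x \<in> ?R" if "\<And>j. \<lbrakk>k \<le> j; j < CARD('n)\<rbrakk> \<Longrightarrow> x $ e j = 0" for x
  proof -
    have "T *v x = (\<Sum>l\<in>UNIV. x $ l *\<^sub>R (T *v axis l 1))"
      by (simp only: matrix_mult_sum[of T x] scalar_mult_eq_scaleR matrix_vector_mult_basis)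
    also have "\<dots> \<in> ?R"
    proof (rule subspace_sum[OF sR])
      fix l
      show "x $ l *\<^sub>R (T *v axis l 1) \<in> ?R"
      proof (cases "ei l < k")
        case True
        thus ?thesis unfolding T_axis by (intro subspace_scale[OF sR] bR)
      next
        case False
        hence "x $ l = 0" using that[of "ei l"] ei_lt[of l] e_ei[of l] by simp
        thus ?thesis using subspace_0[OF sR] by simp
      qed
    qed
    finally show ?thesis .
  qed
  define B where "B = U ** A ** T"
  have B_col: "B $ i $ l = (U *v (A *v b (ei l))) $ i" for i l
  proof -
    have "B $ i $ l = (B *v axis l 1) $ i" by (simp add: matrix_vector_mult_basis column_def)
    also have "B *v axis l 1 = U *v (A *v (T *v axis l 1))"
      by (simp add: B_def matrix_vector_mul_assoc matrix_mul_assoc)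
    finally show ?thesis by (simp only: T_axis)
  qed
  have B_right: "B $ l $ e j = 0" if "k \<le> j" "j < CARD('n)" for l j
    using bN[OF that] that by (simp add: B_col ei)
  have B_low: "B $ e i $ l = 0" if "k \<le> i" "i < CARD('n)" for i l
    unfolding B_col by (rule U_R[OF _ that]) simp
  define C where "C = Matrix.mat k k (\<lambda>(i, j). B $ e i $ e j)"
  define D where "D = Matrix.mat (CARD('n) - k) k (\<lambda>(i, j). B $ e (i + k) $ e j)"
  have C: "C \<in> carrier_mat k k" and D: "D \<in> carrier_mat (CARD('n) - k) k"
    by (simp_all add: C_def D_def)
  have C_ent: "C $$ (i, j) = B $ e i $ e j" if "i < k" "j < k" for i j
    using that by (simp add: C_def)
  have arr: "array_of e B = four_block_mat C (0\<^sub>m k (CARD('n) - k)) D (0\<^sub>m (CARD('n) - k) (CARD('n) - k))"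
    unfolding array_of_four_block_iff[OF k C D] by (auto simp: C_ent D_def B_right)
  have AT: "A ** T = T ** B"
  proof -
    have "T ** B = (T ** U) ** A ** T" by (simp only: B_def matrix_mul_assoc)
    thus ?thesis by (simp add: UT)
  qed
  have specB: "convergent_spectrum B" by (rule convergent_spectrum_similar[OF UT(1) AT A])
  have "hurwitz C"
    unfolding hurwitz_def
  proof (intro conjI allI impI)
    show "square_mat C" using C by simp
    fix \<mu> assume "eigenvalue (map_mat complex_of_real C) \<mu>"
    then obtain v where v: "v \<in> carrier_vec k" "v \<noteq> 0\<^sub>v k"
      "map_mat complex_of_real C *\<^sub>v v = \<mu> \<cdot>\<^sub>v v"
      using C unfolding eigenvalue_def eigenvector_def by auto
    define y :: "complex^'n" where "y = (\<chi> l. if ei l < k then vec_index v (ei l) else 0)"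
    have y_ent: "y $ e j = (if j < k then vec_index v j else 0)" if "j < CARD('n)" for j
      using that by (simp add: y_def ei)
    have vy: "first_block e k y = v"
      using v(1) k by (intro eq_vecI) (auto simp: first_block_def y_ent)
    have "y \<noteq> 0" using v(2) vy by (auto simp: first_block_def)
    have By: "complexify B *v y = \<mu> *s y"
    proof (subst vec_eq_iff, rule allI)
      fix l
      show "(complexify B *v y) $ l = (\<mu> *s y) $ l"
      proof (cases "ei l < k")
        case True
        have "first_block e k (complexify B *v y) = \<mu> \<cdot>\<^sub>v first_block e k y"
          using first_block_mult[OF e k B_right C C_ent, of y] v(3) vy by simp
        from arg_cong[OF this, of "\<lambda>v. vec_index v (ei l)"] True
        show ?thesis by (simp add: first_block_def e_ei)
      next
        case False
        have "y $ l = 0" using False by (simp add: y_def)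
        moreover have "B $ l $ j = 0" for j using B_low[of "ei l" j] False ei_lt e_ei by simp
        ultimately show ?thesis by (simp add: matrix_vector_mult_def complexify_def)
      qed
    qed
    have "\<mu> \<noteq> 0"
    proof
      assume "\<mu> = 0"
      have "re_slice c y = 0" for c
      proof -
        have "B *v re_slice c y = 0"
          using By \<open>\<mu> = 0\<close> by (simp add: matrix_mult_re_slice) (simp add: re_slice_def vec_eq_iff)
        hence "A *v (T *v re_slice c y) = 0"
          by (simp add: matrix_vector_mul_assoc AT flip: matrix_vector_mul_assoc[of T B])
        moreover have "T *v re_slice c y \<in> ?R" by (rule T_R) (simp add: re_slice_def y_ent)
        ultimately have "T *v re_slice c y = 0" using ker by force
        hence "U *v (T *v re_slice c y) = 0" by simp
        thus ?thesis by (simp add: matrix_vector_mul_assoc UT)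
      qed
      thus False using re_slice_eq_0_imp \<open>y \<noteq> 0\<close> by blast
    qed
    thus "Re \<mu> < 0" using specB By \<open>y \<noteq> 0\<close> unfolding convergent_spectrum_def by blast
  qed
  with T k C D arr show ?thesis unfolding hurwitz_block_form_def B_def U_def by blast
qed

section \<open>Equivalence\<close>

theorem proposition2:
  fixes A :: "real^'n^'n" and e :: "nat \<Rightarrow> 'n"
  assumes numbering: "bij_betw e {..<CARD('n)} UNIV"
  defines "a \<equiv> ct_convergent A"
    and "b \<equiv> \<exists>\<epsilon>>0. invertible (id_matrix + \<epsilon> *\<^sub>R A)
                  \<and> ct_stable (A ** matrix_inv (id_matrix + \<epsilon> *\<^sub>R A))"
    and "c \<equiv> \<exists>V. weak_polyhedral_lyapunov A V"
    and "d \<equiv> \<exists>T :: real^'n^'n. invertible T \<and>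
               (\<exists>k\<le>CARD('n). \<exists>A_as \<in> carrier_mat k k. \<exists>A_r \<in> carrier_mat (CARD('n) - k) k.
                  hurwitz A_as \<and>
                  array_of e (matrix_inv T ** A ** T) =
                    four_block_mat A_as (0\<^sub>m k (CARD('n) - k))
                                   A_r  (0\<^sub>m (CARD('n) - k) (CARD('n) - k)))"
    and "e' \<equiv> \<exists>\<tau>>0. dt_convergent (id_matrix + \<tau> *\<^sub>R A)"
    and "f \<equiv> \<exists>\<epsilon>>0. \<exists>P. pos_def P \<and>
               pos_semidef (- (transpose A ** P + P ** A + \<epsilon> *\<^sub>R (transpose A ** P ** A)))"
    and "g \<equiv> \<exists>Q P. pos_def Q \<and> pos_semidef P \<and> rank P = CARD('n) - dim {x. A *v x = 0} \<and>
               pos_semidef (- (transpose A ** P + P ** A + transpose A ** Q ** A))"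
  shows "(a \<longleftrightarrow> b) \<and> (a \<longleftrightarrow> c) \<and> (a \<longleftrightarrow> d) \<and> (a \<longleftrightarrow> e') \<and> (a \<longleftrightarrow> f) \<and> (a \<longleftrightarrow> g)"
proof -
  let ?S = "convergent_spectrum A"
  have f_iff: "f \<longleftrightarrow> (\<exists>\<epsilon> P. dissipative \<epsilon> P A)"
    unfolding f_def dissipative_iff_lyapunov_inequality by blast
  have "a \<Longrightarrow> ?S" unfolding a_def by (rule ct_convergent_imp_spectrum)
  moreover have "b \<Longrightarrow> ?S" unfolding b_def using stable_imp_spectrum by blast
  moreover have "c \<Longrightarrow> ?S" unfolding c_def using polyhedral_lyapunov_imp_spectrum by blast
  moreover have "d \<longleftrightarrow> ?S"
    using hurwitz_block_form_imp_spectrum[OF numbering] spectrum_imp_hurwitz_block_form[OF numbering]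
    unfolding d_def hurwitz_block_form_def by blast
  moreover have "?S \<longleftrightarrow> e'"
    using convergent_spectrum_imp_euler_convergent euler_convergent_imp_spectrum
    unfolding e'_def by blast
  moreover have "f \<Longrightarrow> ?S" unfolding f_iff using dissipative_imp_spectrum by blast
  moreover have "g \<Longrightarrow> f"
    unfolding f_iff g_def using semidefinite_lyapunov_imp_dissipative by blast
  moreover have "e' \<Longrightarrow> c" "e' \<Longrightarrow> f" "e' \<Longrightarrow> g"
    using euler_convergent_imp_polyhedral_lyapunov euler_convergent_imp_lyapunov_inequalities
    unfolding e'_def c_def f_iff g_def by blast+
  moreover have "f \<Longrightarrow> a" "f \<Longrightarrow> b"
    using dissipative_imp_ct_convergent dissipative_imp_resolvent_stable
    unfolding f_iff a_def b_def by blast+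
  ultimately show ?thesis by blast
qed

end
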